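(* Let $L$ and $L^*$ be two Finsler structures on a manifold $M$, with Cartan connections $\nabla,\nabla^*$ and associated $\pi$-tensor fields $A(\overline X,\overline Y)=\nabla^*_{\gamma\overline X}\overline Y-\nabla_{\gamma\overline X}\overline Y$ and $B(\overline X,\overline Y)=\nabla^*_{\beta\overline X}\overline Y-\nabla_{\beta\overline X}\overline Y$. Assume that $B=0$. Let $(M,L)$ (resp. $(M,L^* )$) be a locally Minkowskian manifold. Then $(M,L^* )$ (resp. $(M,L)$) is locally Minkowskian if and only if $\nabla_{\beta\overline X}A=0$ for all $\overline X\in\mathfrak X(\pi(M))$.
   Context: $M$ is a finite-dimensional $C^\infty$ manifold and all objects are $C^\infty$. $\pi:\mathcal TM\to M$ is the bundle of nonzero tangent vectors; $\pi^{-1}(TM)\to\mathcal TM$ is the pullback of $TM$ by $\pi$. Sections of $\pi^{-1}(TM)$ are called $\pi$-vector fields, form the module $\mathfrak X(\pi(M))$, and are written $\overline X$; tensor fields on $\pi^{-1}(TM)$ are called $\pi$-tensor fields. $\overline\eta(u)=(u,u)$ is the fundamental $\pi$-vector field. There is an exact sequence $0\to\pi^{-1}(TM)\xrightarrow{\gamma}T(\mathcal TM)\xrightarrow{\rho}\pi^{-1}(TM)\to0$, where $\gamma(u,v)$ is the vertical lift of $v$ to $u$ and $\rho(X)=(u,d\pi(X))$ for $X\in T_u(\mathcal TM)$. For a connection $\nabla$ on $\pi^{-1}(TM)$, its connection map is $K(X)=\nabla_X\overline\eta$, $X\in T(\mathcal TM)$. The horizontal space is $H_u=\{X\in T_u(\mathcal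 TM):K(X)=0\}$, the vertical space is $V_u=\ker\rho_u$; $\nabla$ is regular if $T_u(\mathcal TM)=V_u\oplus H_u$ for all $u$, and then $\beta=(\rho|_{H})^{-1}:\pi^{-1}(TM)\to H$. The torsion form is $\mathbf T(X,Y)=\nabla_X\rho Y-\nabla_Y\rho X-\rho[X,Y]$, with $S(\overline X,\overline Y)=\mathbf T(\beta\overline X,\beta\overline Y)$ and $T(\overline X,\overline Y)=\mathbf T(\gamma\overline X,\beta\overline Y)$. The curvature is $\mathbf R(X,Y)=[\nabla_Y,\nabla_X]+\nabla_{[X,Y]}$, and $R(\overline X,\overline Y)\overline Z=\mathbf R(\beta\overline X,\beta\overline Y)\overline Z$. A Finsler structure $L:TM\to[0,\infty)$ is smooth on $\mathcal TM$, positively homogeneous of degree 1 on fibres, with $g$ := fibrewise Hessian of $\frac12L^2$ positive definite (a metric on $\pi^{-1}(TM)$). Its Cartan connection is the unique regular connection $\nabla$ on $\pi^{-1}(TM)$ with $\nabla g=0$, $S=0$ and $g(T(\overline X,\overline Y),\overline Z)=g(T(\overline X,\overline Z),\overline Y)$; it satisfies $K\circ\gamma=\mathrm{id}$, so $X=\gamma KX+\beta\rho X$. Objects of $(M,L^* )$ carry an asterisk ($\nabla^*,\beta^*,T^*,R^*,\dots$). Covariant derivatives of $\pi$-tensor fields are the usual ones, e.g. $(\nabla_XA)(\overline Y,\overline Z)=\nabla_X(A(\overline Y,\overline Z))-A(\nabla_X\overline Y,\overline Z)-A(\overline Y,\nabla_X\overline Z)$. $(M,L)$ is locally Minkowskian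 if (and only if) $R=0$ and $\nabla_{\beta\overline X}T=0$ for all $\overline X\in\mathfrak X(\pi(M))$; likewise $(M,L^* )$ is locally Minkowskian if (and only if) $R^*=0$ and $\nabla^*_{\beta^*\overline X}T^*=0$ for all $\overline X$. (This characterization is taken as the definition.) *)

theory Defs
  imports "HOL-Analysis.Analysis" "HOL-Library.Function_Algebras"
begin

text \<open>Smoothness of maps between open subsets of Euclidean spaces.\<close>

primrec Ck_on :: "nat \<Rightarrow> 'e set \<Rightarrow> ('e::euclidean_space \<Rightarrow> 'b::real_normed_vector) \<Rightarrow> bool" where
  "Ck_on 0 S f \<longleftrightarrow> continuous_on S f"
| "Ck_on (Suc k) S f \<longleftrightarrow>
     (\<forall>x\<in>S. f differentiable (at x)) \<and> (\<forall>v. Ck_on k S (\<lambda>x. frechet_derivative f (at x) v))"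

definition smooth_on :: "'e set \<Rightarrow> ('e::euclidean_space \<Rightarrow> 'b::real_normed_vector) \<Rightarrow> bool" where
  "smooth_on S f \<longleftrightarrow> (\<forall>k. Ck_on k S f)"


section \<open>Manifolds and tangent vectors\<close>

text \<open>
  A chart is a pair of a domain and a coordinate map; the values of the coordinate map outside the
  domain are irrelevant.
\<close>

type_synonym ('a, 'e) chart = "'a set \<times> ('a \<Rightarrow> 'e)"

definition chart_image :: "('a, 'e) chart \<Rightarrow> 'e set" where
  "chart_image c = snd c ` fst c"

definition chart_inv :: "('a, 'e) chart \<Rightarrow> 'e \<Rightarrow> 'a" where
  "chart_inv c = inv_into (fst c) (snd c)"

definition carrier :: "('a, 'e) chart set \<Rightarrow> 'a set" where
  "carrier \<A> = \<Union> (fst ` \<A>)"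

definition smooth_manifold :: "'a topology \<Rightarrow> ('a, 'e::euclidean_space) chart set \<Rightarrow> bool" where
  "smooth_manifold M \<A> \<longleftrightarrow>
     Hausdorff_space M \<and> second_countable M \<and> carrier \<A> = topspace M \<and>
     (\<forall>c\<in>\<A>. openin M (fst c) \<and> open (chart_image c) \<and>
        homeomorphic_map (subtopology M (fst c)) (top_of_set (chart_image c)) (snd c)) \<and>
     (\<forall>c\<in>\<A>. \<forall>d\<in>\<A>. smooth_on (snd c ` (fst c \<inter> fst d)) (snd d \<circ> chart_inv c))"

definition smooth_fun :: "('a, 'e::euclidean_space) chart set \<Rightarrow> ('a \<Rightarrow> real) \<Rightarrow> bool" where
  "smooth_fun \<A> f \<longleftrightarrow> (\<forall>c\<in>\<A>. smooth_on (chart_image c) (f \<circ> chart_inv c))"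

text \<open>
  A tangent vector at p is the family of its components in all the charts around p, related by the
  derivatives of the coordinate changes. Components in all other charts are set to 0, so that
  addition and scalar multiplication are those of functions.
\<close>

type_synonym ('a, 'e) tvec = "('a, 'e) chart \<Rightarrow> 'e"

abbreviation tscale :: "real \<Rightarrow> ('c \<Rightarrow> 'e::real_vector) \<Rightarrow> 'c \<Rightarrow> 'e" (infixr "\<odot>" 75) where
  "r \<odot> v \<equiv> (\<lambda>c. r *\<^sub>R v c)"

definition tangent_space :: "('a, 'e::euclidean_space) chart set \<Rightarrow> 'a \<Rightarrow> ('a, 'e) tvec set" where
  "tangent_space \<A> p = {v.
     (\<forall>c. \<not> (c \<in> \<A> \<and> p \<in> fst c) \<longrightarrow> v c = 0) \<and>
     (\<forall>c\<in>\<A>. \<forall>d\<in>\<A>. p \<in> fst c \<and> p \<in> fst d \<longrightarrow>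
        v d = frechet_derivative (snd d \<circ> chart_inv c) (at (snd c p)) (v c))}"

text \<open>
  The derivative of a function at p along a tangent vector, computed in some chart around p. The
  function only has to be defined near p and may take values in any normed space.
\<close>

definition chart_at :: "('a, 'e) chart set \<Rightarrow> 'a \<Rightarrow> ('a, 'e) chart" where
  "chart_at \<A> p = (SOME c. c \<in> \<A> \<and> p \<in> fst c)"

definition deriv_along ::
    "('a, 'e::euclidean_space) chart set \<Rightarrow> 'a \<Rightarrow> ('a, 'e) tvec \<Rightarrow>
      ('a \<Rightarrow> 'b::real_normed_vector) \<Rightarrow> 'b" where
  "deriv_along \<A> p v f =
     (let c = chart_at \<A> p in frechet_derivative (f \<circ> chart_inv c) (at (snd c p)) (v c))"

definition differential ::
    "('a, 'e::euclidean_space) chart set \<Rightarrow> ('b, 'f::euclidean_space) chart set \<Rightarrow>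
      ('a \<Rightarrow> 'b) \<Rightarrow> 'a \<Rightarrow> ('a, 'e) tvec \<Rightarrow> ('b, 'f) tvec" where
  "differential \<A> \<B> f p v =
     (\<lambda>d. if d \<in> \<B> \<and> f p \<in> fst d then deriv_along \<A> p v (snd d \<circ> f) else 0)"

text \<open>The velocity at time 0 of a curve.\<close>

definition velocity :: "('a, 'e::euclidean_space) chart set \<Rightarrow> (real \<Rightarrow> 'a) \<Rightarrow> ('a, 'e) tvec" where
  "velocity \<A> \<sigma> =
     (\<lambda>c. if c \<in> \<A> \<and> \<sigma> 0 \<in> fst c then vector_derivative (snd c \<circ> \<sigma>) (at 0) else 0)"

text \<open>The tangent vector at p whose component in the chart c is e.\<close>

definition coord_vec ::
    "('a, 'e::euclidean_space) chart set \<Rightarrow> ('a, 'e) chart \<Rightarrow> 'e \<Rightarrow> 'a \<Rightarrow> ('a, 'e) tvec" where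
  "coord_vec \<A> c e p =
     (\<lambda>d. if d \<in> \<A> \<and> p \<in> fst d
          then frechet_derivative (snd d \<circ> chart_inv c) (at (snd c p)) e else 0)"

text \<open>
  In every chart, the components of the bracket are given by
  \<open>[X, Y]\<^sup>i = X(Y\<^sup>i) - Y(X\<^sup>i)\<close>.
\<close>

definition lie_bracket ::
    "('a, 'e::euclidean_space) chart set \<Rightarrow> ('a \<Rightarrow> ('a, 'e) tvec) \<Rightarrow> ('a \<Rightarrow> ('a, 'e) tvec) \<Rightarrow>
      'a \<Rightarrow> ('a, 'e) tvec" where
  "lie_bracket \<A> X Y p =
     (\<lambda>c. if c \<in> \<A> \<and> p \<in> fst c
          then deriv_along \<A> p (X p) (\<lambda>q. Y q c) - deriv_along \<A> p (Y p) (\<lambda>q. X q c) else 0)"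


section \<open>The bundle of nonzero tangent vectors\<close>

type_synonym ('a, 'e) tpoint = "'a \<times> ('a, 'e) tvec"

type_synonym ('a, 'e) ttvec = "(('a, 'e) tpoint, 'e \<times> 'e) tvec"

definition slit_bundle :: "('a, 'e::euclidean_space) chart set \<Rightarrow> ('a, 'e) tpoint set" where
  "slit_bundle \<A> = {(p, v). p \<in> carrier \<A> \<and> v \<in> tangent_space \<A> p \<and> v \<noteq> 0}"

definition slit_chart ::
    "('a, 'e::euclidean_space) chart set \<Rightarrow> ('a, 'e) chart \<Rightarrow> (('a, 'e) tpoint, 'e \<times> 'e) chart" where
  "slit_chart \<A> c = ({u \<in> slit_bundle \<A>. fst u \<in> fst c}, \<lambda>(p, v). (snd c p, v c))"

definition slit_atlas ::
    "('a, 'e::euclidean_space) chart set \<Rightarrow> (('a, 'e) tpoint, 'e \<times> 'e) chart set" where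
  "slit_atlas \<A> = slit_chart \<A> ` \<A>"

text \<open>
  A section of the pulled-back bundle assigns to a nonzero tangent vector u at p a tangent vector
  at p. Its values outside the slit bundle are irrelevant.
\<close>

definition pi_fields ::
    "('a, 'e::euclidean_space) chart set \<Rightarrow> (('a, 'e) tpoint \<Rightarrow> ('a, 'e) tvec) set" where
  "pi_fields \<A> = {Y.
     (\<forall>u\<in>slit_bundle \<A>. Y u \<in> tangent_space \<A> (fst u)) \<and>
     (\<forall>c\<in>\<A>. smooth_on (chart_image (slit_chart \<A> c)) (\<lambda>z. Y (chart_inv (slit_chart \<A> c) z) c))}"

definition eta :: "('a, 'e) tpoint \<Rightarrow> ('a, 'e) tvec" where
  "eta u = snd u"

definition vert_lift ::
    "('a, 'e::euclidean_space) chart set \<Rightarrow> ('a, 'e) tpoint \<Rightarrow> ('a, 'e) tvec \<Rightarrow> ('a, 'e) ttvec" where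
  "vert_lift \<A> u v = velocity (slit_atlas \<A>) (\<lambda>t. (fst u, snd u + t \<odot> v))"

definition rho ::
    "('a, 'e::euclidean_space) chart set \<Rightarrow> ('a, 'e) tpoint \<Rightarrow> ('a, 'e) ttvec \<Rightarrow> ('a, 'e) tvec" where
  "rho \<A> u X = differential (slit_atlas \<A>) \<A> fst u X"


section \<open>Connections on the pulled-back bundle\<close>

text \<open>
  \<open>D u X Y\<close> is the covariant derivative of the section Y along the tangent vector X of the slit
  bundle at u.
\<close>

type_synonym ('a, 'e) conn =
  "('a, 'e) tpoint \<Rightarrow> ('a, 'e) ttvec \<Rightarrow> (('a, 'e) tpoint \<Rightarrow> ('a, 'e) tvec) \<Rightarrow> ('a, 'e) tvec"

text \<open>
  The congruence condition says that the connection acts on sections over the slit bundle, which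
  are represented by total functions. The last condition says that the covariant differential of a
  smooth section is smooth, tested on the coordinate frames of the slit bundle.
\<close>

definition connection :: "('a, 'e::euclidean_space) chart set \<Rightarrow> ('a, 'e) conn \<Rightarrow> bool" where
  "connection \<A> D \<longleftrightarrow>
     (\<forall>u\<in>slit_bundle \<A>. \<forall>X\<in>tangent_space (slit_atlas \<A>) u. \<forall>Y\<in>pi_fields \<A>.
        D u X Y \<in> tangent_space \<A> (fst u) \<and>
        (\<forall>Z\<in>pi_fields \<A>. (\<forall>w\<in>slit_bundle \<A>. Y w = Z w) \<longrightarrow> D u X Y = D u X Z) \<and>
        (\<forall>W\<in>tangent_space (slit_atlas \<A>) u. \<forall>a b.
           D u (a \<odot> X + b \<odot> W) Y = a \<odot> D u X Y + b \<odot> D u W Y) \<and>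
        (\<forall>Z\<in>pi_fields \<A>. D u X (\<lambda>w. Y w + Z w) = D u X Y + D u X Z) \<and>
        (\<forall>f. smooth_fun (slit_atlas \<A>) f \<longrightarrow>
           D u X (\<lambda>w. f w \<odot> Y w) = deriv_along (slit_atlas \<A>) u X f \<odot> Y u + f u \<odot> D u X Y)) \<and>
     (\<forall>Y\<in>pi_fields \<A>. \<forall>c\<in>\<A>. \<forall>e. smooth_on (chart_image (slit_chart \<A> c))
        (\<lambda>z. let u = chart_inv (slit_chart \<A> c) z
             in D u (coord_vec (slit_atlas \<A>) (slit_chart \<A> c) e u) Y c))"

definition conn_map :: "('a, 'e) conn \<Rightarrow> ('a, 'e) tpoint \<Rightarrow> ('a, 'e) ttvec \<Rightarrow> ('a, 'e) tvec" where
  "conn_map D u X = D u X eta"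

definition horizontal ::
    "('a, 'e::euclidean_space) chart set \<Rightarrow> ('a, 'e) conn \<Rightarrow> ('a, 'e) tpoint \<Rightarrow> ('a, 'e) ttvec set" where
  "horizontal \<A> D u = {X \<in> tangent_space (slit_atlas \<A>) u. conn_map D u X = 0}"

definition vertical ::
    "('a, 'e::euclidean_space) chart set \<Rightarrow> ('a, 'e) tpoint \<Rightarrow> ('a, 'e) ttvec set" where
  "vertical \<A> u = {X \<in> tangent_space (slit_atlas \<A>) u. rho \<A> u X = 0}"

definition regular :: "('a, 'e::euclidean_space) chart set \<Rightarrow> ('a, 'e) conn \<Rightarrow> bool" where
  "regular \<A> D \<longleftrightarrow> (\<forall>u\<in>slit_bundle \<A>.
     tangent_space (slit_atlas \<A>) u = {X + Y | X Y. X \<in> vertical \<A> u \<and> Y \<in> horizontal \<A> D u} \<and>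
     vertical \<A> u \<inter> horizontal \<A> D u = {0})"

definition beta ::
    "('a, 'e::euclidean_space) chart set \<Rightarrow> ('a, 'e) conn \<Rightarrow> ('a, 'e) tpoint \<Rightarrow>
      ('a, 'e) tvec \<Rightarrow> ('a, 'e) ttvec" where
  "beta \<A> D u = inv_into (horizontal \<A> D u) (rho \<A> u)"

definition vert_field ::
    "('a, 'e::euclidean_space) chart set \<Rightarrow> (('a, 'e) tpoint \<Rightarrow> ('a, 'e) tvec) \<Rightarrow>
      ('a, 'e) tpoint \<Rightarrow> ('a, 'e) ttvec" where
  "vert_field \<A> X u = vert_lift \<A> u (X u)"

definition hor_field ::
    "('a, 'e::euclidean_space) chart set \<Rightarrow> ('a, 'e) conn \<Rightarrow>
      (('a, 'e) tpoint \<Rightarrow> ('a, 'e) tvec) \<Rightarrow> ('a, 'e) tpoint \<Rightarrow> ('a, 'e) ttvec" where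
  "hor_field \<A> D X u = beta \<A> D u (X u)"

definition nabla ::
    "('a, 'e) conn \<Rightarrow> (('a, 'e) tpoint \<Rightarrow> ('a, 'e) ttvec) \<Rightarrow>
      (('a, 'e) tpoint \<Rightarrow> ('a, 'e) tvec) \<Rightarrow> ('a, 'e) tpoint \<Rightarrow> ('a, 'e) tvec" where
  "nabla D X Y u = D u (X u) Y"

definition torsion_form ::
    "('a, 'e::euclidean_space) chart set \<Rightarrow> ('a, 'e) conn \<Rightarrow>
      (('a, 'e) tpoint \<Rightarrow> ('a, 'e) ttvec) \<Rightarrow> (('a, 'e) tpoint \<Rightarrow> ('a, 'e) ttvec) \<Rightarrow>
      ('a, 'e) tpoint \<Rightarrow> ('a, 'e) tvec" where
  "torsion_form \<A> D X Y u =
     nabla D X (\<lambda>w. rho \<A> w (Y w)) u - nabla D Y (\<lambda>w. rho \<A> w (X w)) u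
     - rho \<A> u (lie_bracket (slit_atlas \<A>) X Y u)"

definition S_tensor ::
    "('a, 'e::euclidean_space) chart set \<Rightarrow> ('a, 'e) conn \<Rightarrow>
      (('a, 'e) tpoint \<Rightarrow> ('a, 'e) tvec) \<Rightarrow> (('a, 'e) tpoint \<Rightarrow> ('a, 'e) tvec) \<Rightarrow>
      ('a, 'e) tpoint \<Rightarrow> ('a, 'e) tvec" where
  "S_tensor \<A> D X Y = torsion_form \<A> D (hor_field \<A> D X) (hor_field \<A> D Y)"

definition T_tensor ::
    "('a, 'e::euclidean_space) chart set \<Rightarrow> ('a, 'e) conn \<Rightarrow>
      (('a, 'e) tpoint \<Rightarrow> ('a, 'e) tvec) \<Rightarrow> (('a, 'e) tpoint \<Rightarrow> ('a, 'e) tvec) \<Rightarrow>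
      ('a, 'e) tpoint \<Rightarrow> ('a, 'e) tvec" where
  "T_tensor \<A> D X Y = torsion_form \<A> D (vert_field \<A> X) (hor_field \<A> D Y)"

text \<open>The sign convention is \<open>R(X, Y) = [\<nabla>\<^sub>Y, \<nabla>\<^sub>X] + \<nabla>\<^bsub>[X, Y]\<^esub>\<close>.\<close>

definition curvature_form ::
    "('a, 'e::euclidean_space) chart set \<Rightarrow> ('a, 'e) conn \<Rightarrow>
      (('a, 'e) tpoint \<Rightarrow> ('a, 'e) ttvec) \<Rightarrow> (('a, 'e) tpoint \<Rightarrow> ('a, 'e) ttvec) \<Rightarrow>
      (('a, 'e) tpoint \<Rightarrow> ('a, 'e) tvec) \<Rightarrow> ('a, 'e) tpoint \<Rightarrow> ('a, 'e) tvec" where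
  "curvature_form \<A> D X Y Z u =
     nabla D Y (nabla D X Z) u - nabla D X (nabla D Y Z) u
     + nabla D (lie_bracket (slit_atlas \<A>) X Y) Z u"

definition R_tensor ::
    "('a, 'e::euclidean_space) chart set \<Rightarrow> ('a, 'e) conn \<Rightarrow>
      (('a, 'e) tpoint \<Rightarrow> ('a, 'e) tvec) \<Rightarrow> (('a, 'e) tpoint \<Rightarrow> ('a, 'e) tvec) \<Rightarrow>
      (('a, 'e) tpoint \<Rightarrow> ('a, 'e) tvec) \<Rightarrow> ('a, 'e) tpoint \<Rightarrow> ('a, 'e) tvec" where
  "R_tensor \<A> D X Y = curvature_form \<A> D (hor_field \<A> D X) (hor_field \<A> D Y)"

text \<open>
  Covariant derivative, along a vector field X on the slit bundle, of a tensor field with two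
  arguments and values in the pulled-back bundle. Tensor fields are represented as operators on
  sections.
\<close>

definition nabla_tensor ::
    "('a, 'e::euclidean_space) conn \<Rightarrow> (('a, 'e) tpoint \<Rightarrow> ('a, 'e) ttvec) \<Rightarrow>
      ((('a, 'e) tpoint \<Rightarrow> ('a, 'e) tvec) \<Rightarrow> (('a, 'e) tpoint \<Rightarrow> ('a, 'e) tvec) \<Rightarrow>
        ('a, 'e) tpoint \<Rightarrow> ('a, 'e) tvec) \<Rightarrow>
      (('a, 'e) tpoint \<Rightarrow> ('a, 'e) tvec) \<Rightarrow> (('a, 'e) tpoint \<Rightarrow> ('a, 'e) tvec) \<Rightarrow>
      ('a, 'e) tpoint \<Rightarrow> ('a, 'e) tvec" where
  "nabla_tensor D X F Y Z u =
     nabla D X (F Y Z) u - F (nabla D X Y) Z u - F Y (nabla D X Z) u"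


section \<open>Finsler structures and Cartan connections\<close>

type_synonym ('a, 'e) lagr = "('a, 'e) tpoint \<Rightarrow> real"

text \<open>The fibrewise Hessian of half the square of L, at u.\<close>

definition fund_tensor ::
    "('a, 'e::euclidean_space) lagr \<Rightarrow> ('a, 'e) tpoint \<Rightarrow> ('a, 'e) tvec \<Rightarrow> ('a, 'e) tvec \<Rightarrow> real" where
  "fund_tensor L u v w =
     deriv (\<lambda>s. deriv (\<lambda>t. (L (fst u, snd u + s \<odot> v + t \<odot> w))\<^sup>2 / 2) 0) 0"

definition finsler_structure ::
    "('a, 'e::euclidean_space) chart set \<Rightarrow> ('a, 'e) lagr \<Rightarrow> bool" where
  "finsler_structure \<A> L \<longleftrightarrow>
     (\<forall>p\<in>carrier \<A>. \<forall>v\<in>tangent_space \<A> p. L (p, v) \<ge> 0 \<and> (\<forall>r>0. L (p, r \<odot> v) = r * L (p, v))) \<and>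
     smooth_fun (slit_atlas \<A>) L \<and>
     (\<forall>u\<in>slit_bundle \<A>. \<forall>v\<in>tangent_space \<A> (fst u). v \<noteq> 0 \<longrightarrow> fund_tensor L u v v > 0)"

definition cartan_connection ::
    "('a, 'e::euclidean_space) chart set \<Rightarrow> ('a, 'e) lagr \<Rightarrow> ('a, 'e) conn \<Rightarrow> bool" where
  "cartan_connection \<A> L D \<longleftrightarrow>
     connection \<A> D \<and> regular \<A> D \<and>
     (\<forall>u\<in>slit_bundle \<A>. \<forall>X\<in>tangent_space (slit_atlas \<A>) u. \<forall>Y\<in>pi_fields \<A>. \<forall>Z\<in>pi_fields \<A>.
        deriv_along (slit_atlas \<A>) u X (\<lambda>w. fund_tensor L w (Y w) (Z w)) =
        fund_tensor L u (D u X Y) (Z u) + fund_tensor L u (Y u) (D u X Z)) \<and>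
     (\<forall>X\<in>pi_fields \<A>. \<forall>Y\<in>pi_fields \<A>. \<forall>u\<in>slit_bundle \<A>. S_tensor \<A> D X Y u = 0) \<and>
     (\<forall>X\<in>pi_fields \<A>. \<forall>Y\<in>pi_fields \<A>. \<forall>Z\<in>pi_fields \<A>. \<forall>u\<in>slit_bundle \<A>.
        fund_tensor L u (T_tensor \<A> D X Y u) (Z u) = fund_tensor L u (T_tensor \<A> D X Z u) (Y u))"

text \<open>
  The property of the Finsler manifold with structure L is expressed through its Cartan
  connection D.
\<close>

definition locally_minkowskian ::
    "('a, 'e::euclidean_space) chart set \<Rightarrow> ('a, 'e) lagr \<Rightarrow> ('a, 'e) conn \<Rightarrow> bool" where
  "locally_minkowskian \<A> L D \<longleftrightarrow>
     finsler_structure \<A> L \<and> cartan_connection \<A> L D \<and>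
     (\<forall>X\<in>pi_fields \<A>. \<forall>Y\<in>pi_fields \<A>. \<forall>Z\<in>pi_fields \<A>. \<forall>u\<in>slit_bundle \<A>.
        R_tensor \<A> D X Y Z u = 0) \<and>
     (\<forall>X\<in>pi_fields \<A>. \<forall>Y\<in>pi_fields \<A>. \<forall>Z\<in>pi_fields \<A>. \<forall>u\<in>slit_bundle \<A>.
        nabla_tensor D (hor_field \<A> D X) (T_tensor \<A> D) Y Z u = 0)"

text \<open>
  The two difference tensors of a pair of connections. The horizontal lift is that of the first
  connection.
\<close>

definition A_tensor ::
    "('a, 'e::euclidean_space) chart set \<Rightarrow> ('a, 'e) conn \<Rightarrow> ('a, 'e) conn \<Rightarrow>
      (('a, 'e) tpoint \<Rightarrow> ('a, 'e) tvec) \<Rightarrow> (('a, 'e) tpoint \<Rightarrow> ('a, 'e) tvec) \<Rightarrow>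
      ('a, 'e) tpoint \<Rightarrow> ('a, 'e) tvec" where
  "A_tensor \<A> D D' X Y u = nabla D' (vert_field \<A> X) Y u - nabla D (vert_field \<A> X) Y u"

definition B_tensor ::
    "('a, 'e::euclidean_space) chart set \<Rightarrow> ('a, 'e) conn \<Rightarrow> ('a, 'e) conn \<Rightarrow>
      (('a, 'e) tpoint \<Rightarrow> ('a, 'e) tvec) \<Rightarrow> (('a, 'e) tpoint \<Rightarrow> ('a, 'e) tvec) \<Rightarrow>
      ('a, 'e) tpoint \<Rightarrow> ('a, 'e) tvec" where
  "B_tensor \<A> D D' X Y u = nabla D' (hor_field \<A> D X) Y u - nabla D (hor_field \<A> D X) Y u"

end

theory Submission
  imports Defs
begin

text \<open>
  The reason for the theorem is that \<open>B = 0\<close> makes the two connections indistinguishable in horizontal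
  directions. Applied to the fundamental section \<open>\<eta>\<close>, the hypothesis says that \<open>\<nabla>\<^sup>*\<eta>\<close> vanishes along \<open>\<beta>X\<close>;
  hence \<open>\<beta>X\<close> is horizontal for \<open>\<nabla>\<^sup>*\<close> as well, \<open>\<beta>\<^sup>* = \<beta>\<close>, and \<open>\<nabla>\<^sup>*\<close> and \<open>\<nabla>\<close> agree along it. This situation,
  which is symmetric in the two connections, is the locale \<open>equal_horizontal_transport\<close>. It has two
  consequences.

  \<^item> The mixed torsion is \<open>T(X, Y) = \<nabla>\<^bsub>\<gamma>X\<^esub>Y - \<rho>[\<gamma>X, \<beta>Y]\<close> (\<open>T_tensor_eq\<close>). With equal lifts the brackets
    cancel and \<open>T\<^sup>* - T = A\<close>. Taking horizontal derivatives, \<open>\<nabla>\<^bsub>\<beta>X\<^esub>A = \<nabla>\<^sup>*\<^bsub>\<beta>X\<^esub>T\<^sup>* - \<nabla>\<^bsub>\<beta>X\<^esub>T\<close>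
    (\<open>nabla_A_tensor\<close>), so if one torsion is parallel, then the other one is if and only if \<open>\<nabla>\<^bsub>\<beta>X\<^esub>A = 0\<close>.

  \<^item> One curvature \<open>R\<close> vanishes if and only if the other does. Indeed \<open>R(X, Y)\<eta>\<close> is the value of the connection
    map on \<open>[\<beta>X, \<beta>Y]\<close>. If \<open>R = 0\<close>, the bracket is horizontal; as \<open>S = 0\<close>, it is the horizontal
    lift of the section \<open>\<nabla>\<^bsub>\<beta>X\<^esub>Y - \<nabla>\<^bsub>\<beta>Y\<^esub>X\<close> (\<open>flat_bracket_hor_field\<close>). So both connections
    agree along the bracket too, and the curvatures coincide (\<open>R_tensor_eq_of_flat\<close>).

  A connection is only known to behave well on smooth sections and on genuine tangent vectors. Most
  of the work is therefore to show that the fields in this argument are smooth and that the brackets are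
  tangent. The bracket of two vector fields is tangent by symmetry of second derivatives
  (\<open>lie_bracket_tangent\<close>), applied to the coordinate changes of the slit bundle. The horizontal lift is smooth
  because its vertical component solves a linear system with smooth coefficients, which is uniquely solvable by
  regularity (\<open>Ck_on_solution\<close>, \<open>hor_field_vector_field\<close>).
\<close>

section \<open>Maps of class \<open>C\<^sup>k\<close>\<close>

lemma linear_Basis_expansion:
  fixes f :: "'e::euclidean_space \<Rightarrow> 'b::real_vector"
  assumes "linear f"
  shows "f e = (\<Sum>i\<in>Basis. (e \<bullet> i) *\<^sub>R f i)"
proof -
  have "f e = f (\<Sum>i\<in>Basis. (e \<bullet> i) *\<^sub>R i)" by (simp add: euclidean_representation)
  also have "\<dots> = (\<Sum>i\<in>Basis. (e \<bullet> i) *\<^sub>R f i)"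
    unfolding linear_sum[OF assms] linear_cmul[OF assms] ..
  finally show ?thesis .
qed

lemma frechet_derivative_cong_open:
  assumes "open S" "x \<in> S" "\<And>y. y \<in> S \<Longrightarrow> f y = g y"
  shows "frechet_derivative f (at x) = frechet_derivative g (at x)"
proof -
  have "(f has_derivative f') (at x) \<longleftrightarrow> (g has_derivative f') (at x)" for f'
    using assms has_derivative_transform_within_open[of _ f' x UNIV S] by metis
  then show ?thesis unfolding frechet_derivative_def by simp
qed

lemma Ck_on_cong:
  assumes "open S" "\<And>y. y \<in> S \<Longrightarrow> f y = g y" "Ck_on k S f"
  shows "Ck_on k S g"
  using assms(2,3)
proof (induction k arbitrary: f g)
  case 0
  then show ?case using continuous_on_cong by fastforce
next
  case (Suc k)
  have "g differentiable (at x)" if "x \<in> S" for x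
    using Suc.prems assms(1) that
    by (metis Ck_on.simps(2) differentiable_def has_derivative_transform_within_open)
  moreover have "Ck_on k S (\<lambda>x. frechet_derivative g (at x) v)" for v
    by (rule Suc.IH[of "\<lambda>x. frechet_derivative f (at x) v"])
      (use Suc.prems frechet_derivative_cong_open[OF assms(1), of _ f g] in auto)
  ultimately show ?case by simp
qed

lemma Ck_on_continuous: "Ck_on k S f \<Longrightarrow> continuous_on S f"
  by (cases k) (auto intro!: continuous_at_imp_continuous_on differentiable_imp_continuous_within)

lemma Ck_on_SucD: "Ck_on (Suc k) S f \<Longrightarrow> Ck_on k S f"
proof (induction k arbitrary: f)
  case 0
  then show ?case using Ck_on_continuous by fastforce
qed auto

text \<open>
  \<^const>\<open>Ck_on\<close> speaks about \<^const>\<open>frechet_derivative\<close>, which no calculus rule produces; here a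
  derivative found by such rules can be used, provided that it is one at every point of an open set.
\<close>
lemma Ck_on_SucI:
  assumes "open S" "\<And>x. x \<in> S \<Longrightarrow> (f has_derivative f' x) (at x)" "\<And>v. Ck_on k S (\<lambda>x. f' x v)"
  shows "Ck_on (Suc k) S f"
proof -
  have *: "frechet_derivative f (at x) = f' x" if "x \<in> S" for x
    using assms(2)[OF that] frechet_derivative_at by metis
  have "Ck_on k S (\<lambda>x. frechet_derivative f (at x) v)" for v
    by (rule Ck_on_cong[OF assms(1) _ assms(3)[of v]]) (simp add: *)
  then show ?thesis using assms(2) by (auto simp: differentiable_def)
qed

lemma Ck_on_SucD_derivative:
  assumes "Ck_on (Suc k) S f" "x \<in> S"
  shows "(f has_derivative frechet_derivative f (at x)) (at x)"
  using assms by (simp add: frechet_derivative_works)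

lemma Ck_on_const [intro]: "open S \<Longrightarrow> Ck_on k S (\<lambda>x. a)"
  by (induction k arbitrary: a) auto

lemma Ck_on_bounded_linear_comp:
  assumes "open S" "bounded_linear l" "Ck_on k S f"
  shows "Ck_on k S (\<lambda>x. l (f x))"
  using assms(3)
proof (induction k arbitrary: f)
  case 0
  then show ?case using assms(2) by (auto intro: bounded_linear.continuous_on)
next
  case (Suc k)
  show ?case
    by (rule Ck_on_SucI[OF assms(1), where f' = "\<lambda>x v. l (frechet_derivative f (at x) v)"])
      (use Suc bounded_linear.has_derivative[OF assms(2) Ck_on_SucD_derivative[OF Suc.prems]] in auto)
qed

lemma Ck_on_bounded_linear:
  assumes "open S" "bounded_linear l"
  shows "Ck_on k S l"
proof (cases k)
  case 0
  then show ?thesis using assms(2) by (simp add: linear_continuous_on)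
next
  case (Suc k)
  show ?thesis unfolding Suc
    by (rule Ck_on_SucI[OF assms(1), where f' = "\<lambda>x. l"])
      (use assms bounded_linear_imp_has_derivative in auto)
qed

lemma Ck_on_add:
  assumes "open S" "Ck_on k S f" "Ck_on k S g"
  shows "Ck_on k S (\<lambda>x. f x + g x)"
  using assms(2,3)
proof (induction k arbitrary: f g)
  case 0
  then show ?case by (auto intro: continuous_intros)
next
  case (Suc k)
  show ?case
    by (rule Ck_on_SucI[OF assms(1), where f' = "\<lambda>x v. frechet_derivative f (at x) v + frechet_derivative g (at x) v"])
      (use Suc has_derivative_add[OF Ck_on_SucD_derivative[OF Suc.prems(1)] Ck_on_SucD_derivative[OF Suc.prems(2)]] in auto)
qed

lemma Ck_on_minus: "open S \<Longrightarrow> Ck_on k S f \<Longrightarrow> Ck_on k S (\<lambda>x. - f x)"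
  by (rule Ck_on_bounded_linear_comp) (auto intro: bounded_linear_minus bounded_linear_ident)

lemma Ck_on_diff:
  "open S \<Longrightarrow> Ck_on k S f \<Longrightarrow> Ck_on k S g \<Longrightarrow> Ck_on k S (\<lambda>x. f x - g x)"
  using Ck_on_add[of S k f "\<lambda>x. - g x"] Ck_on_minus by auto

lemma Ck_on_sum:
  assumes "open S" "\<And>i. i \<in> I \<Longrightarrow> Ck_on k S (f i)"
  shows "Ck_on k S (\<lambda>x. \<Sum>i\<in>I. f i x)"
  using assms(2) by (induction I rule: infinite_finite_induct) (auto intro: assms Ck_on_add)

lemma Ck_on_scaleR:
  assumes "open S" "Ck_on k S f" "Ck_on k S g"
  shows "Ck_on k S (\<lambda>x. f x *\<^sub>R g x)"
  using assms(2,3)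
proof (induction k arbitrary: f g)
  case 0
  then show ?case by (auto intro: continuous_intros)
next
  case (Suc k)
  note d = has_derivative_scaleR[OF Ck_on_SucD_derivative[OF Suc.prems(1)] Ck_on_SucD_derivative[OF Suc.prems(2)]]
  have "Ck_on k S (\<lambda>x. f x *\<^sub>R frechet_derivative g (at x) v + frechet_derivative f (at x) v *\<^sub>R g x)" for v
  proof (rule Ck_on_add[OF assms(1)])
    show "Ck_on k S (\<lambda>x. f x *\<^sub>R frechet_derivative g (at x) v)"
      using Suc.prems by (intro Suc.IH) (simp_all add: Ck_on_SucD)
    show "Ck_on k S (\<lambda>x. frechet_derivative f (at x) v *\<^sub>R g x)"
      using Suc.prems by (intro Suc.IH) (simp_all add: Ck_on_SucD)
  qed
  with d show ?case
    by (intro Ck_on_SucI[OF assms(1), where f' = "\<lambda>x v. f x *\<^sub>R frechet_derivative g (at x) v + frechet_derivative f (at x) v *\<^sub>R g x"])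
      simp_all
qed

lemma Ck_on_compose_linear:
  assumes "open S" "open T" "bounded_linear l" "l ` T \<subseteq> S" "Ck_on k S f"
  shows "Ck_on k T (\<lambda>x. f (l x))"
  using assms(5)
proof (induction k arbitrary: f)
  case 0
  then show ?case
    using continuous_on_compose2[OF _ linear_continuous_on[OF assms(3)] assms(4), of f] by simp
next
  case (Suc k)
  have "((\<lambda>x. f (l x)) has_derivative (\<lambda>v. frechet_derivative f (at (l x)) (l v))) (at x)"
    if "x \<in> T" for x
  proof -
    have "(f has_derivative frechet_derivative f (at (l x))) (at (l x))"
      using Ck_on_SucD_derivative[OF Suc.prems, of "l x"] that assms(4) by auto
    from has_derivative_compose[OF bounded_linear_imp_has_derivative[OF assms(3)] this]
    show ?thesis .
  qed
  then show ?case
    by (rule Ck_on_SucI[OF assms(2)]) (use Suc in auto)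
qed

text \<open>
  On a finite-dimensional space, a family of linear maps depends smoothly on a parameter as soon as
  its value at every fixed vector does: expanding the argument in the standard basis reduces
  \<open>G z (h z)\<close> to finitely many products of a scalar and a vector. This replaces a calculus of
  operator-valued maps in all that follows.
\<close>
lemma Ck_on_linear_family:
  fixes G :: "'e::euclidean_space \<Rightarrow> 'f::euclidean_space \<Rightarrow> 'b::real_normed_vector"
  assumes "open S" "\<And>z. z \<in> S \<Longrightarrow> linear (G z)" "\<And>e. Ck_on k S (\<lambda>z. G z e)" "Ck_on k S h"
  shows "Ck_on k S (\<lambda>z. G z (h z))"
proof (rule Ck_on_cong[OF assms(1)])
  show "Ck_on k S (\<lambda>z. \<Sum>i\<in>Basis. (h z \<bullet> i) *\<^sub>R G z i)"
    by (intro Ck_on_sum Ck_on_scaleR assms Ck_on_bounded_linear_comp[OF _ bounded_linear_inner_left])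
  fix z assume "z \<in> S"
  then show "(\<Sum>i\<in>Basis. (h z \<bullet> i) *\<^sub>R G z i) = G z (h z)"
    using linear_Basis_expansion[OF assms(2)] by metis
qed

text \<open>
  The product rule for \<open>G z (h z)\<close>, where the derivative of \<open>G\<close> is again only known vector by vector.
\<close>
lemma has_derivative_linear_family:
  fixes G :: "'e::euclidean_space \<Rightarrow> 'f::euclidean_space \<Rightarrow> 'b::real_normed_vector"
  assumes "open S" "x \<in> S" "\<And>z. z \<in> S \<Longrightarrow> linear (G z)"
    and G': "\<And>e. ((\<lambda>z. G z e) has_derivative (\<lambda>v. G' v e)) (at x)"
    and h': "(h has_derivative h') (at x)"
  shows "((\<lambda>z. G z (h z)) has_derivative (\<lambda>v. G x (h' v) + G' v (h x))) (at x)"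
proof -
  have repr: "G z e = (\<Sum>i\<in>Basis. (e \<bullet> i) *\<^sub>R G z i)" if "z \<in> S" for z e
    using assms(3)[OF that] by (rule linear_Basis_expansion)
  have "((\<lambda>z. \<Sum>i\<in>Basis. (e \<bullet> i) *\<^sub>R G z i) has_derivative (\<lambda>v. \<Sum>i\<in>Basis. (e \<bullet> i) *\<^sub>R G' v i)) (at x)" for e
    by (intro has_derivative_sum has_derivative_scaleR_right G')
  then have "((\<lambda>z. G z e) has_derivative (\<lambda>v. \<Sum>i\<in>Basis. (e \<bullet> i) *\<^sub>R G' v i)) (at x)" for e
    by (rule has_derivative_transform_within_open[OF _ assms(1,2)]) (simp add: repr[symmetric])
  then have repr': "G' v e = (\<Sum>i\<in>Basis. (e \<bullet> i) *\<^sub>R G' v i)" for v e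
    using has_derivative_unique[OF G'] by metis
  have "((\<lambda>z. \<Sum>i\<in>Basis. (h z \<bullet> i) *\<^sub>R G z i) has_derivative
      (\<lambda>v. \<Sum>i\<in>Basis. ((h x \<bullet> i) *\<^sub>R G' v i + (h' v \<bullet> i) *\<^sub>R G x i))) (at x)"
    by (intro has_derivative_sum has_derivative_scaleR G' has_derivative_inner_left h')
  also have "(\<lambda>v. \<Sum>i\<in>Basis. ((h x \<bullet> i) *\<^sub>R G' v i + (h' v \<bullet> i) *\<^sub>R G x i)) = (\<lambda>v. G x (h' v) + G' v (h x))"
  proof
    fix v
    show "(\<Sum>i\<in>Basis. ((h x \<bullet> i) *\<^sub>R G' v i + (h' v \<bullet> i) *\<^sub>R G x i)) = G x (h' v) + G' v (h x)"
      unfolding sum.distrib repr[OF assms(2), of "h' v"] repr'[of v "h x"] by (rule add.commute)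
  qed
  finally show ?thesis
    by (rule has_derivative_transform_within_open[OF _ assms(1,2)]) (simp add: repr[symmetric])
qed


section \<open>Smooth dependence of the solution of a linear system\<close>

lemma linear_family_derivative_linear:
  fixes G :: "'e::euclidean_space \<Rightarrow> 'f::euclidean_space \<Rightarrow> 'b::real_normed_vector"
  assumes "open S" "x \<in> S" "\<And>z. z \<in> S \<Longrightarrow> linear (G z)"
    and d: "\<And>e. (\<lambda>z. G z e) differentiable (at x)"
  shows "linear (\<lambda>e. frechet_derivative (\<lambda>z. G z e) (at x) v)"
proof (rule linearI)
  note D = d[unfolded frechet_derivative_works]
  fix a b r
  have "((\<lambda>z. G z (a + b)) has_derivative (\<lambda>v. frechet_derivative (\<lambda>z. G z a) (at x) v + frechet_derivative (\<lambda>z. G z b) (at x) v)) (at x)"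
    by (rule has_derivative_transform_within_open[OF has_derivative_add[OF D D] assms(1,2)])
      (simp add: assms(3) linear_add)
  then show "frechet_derivative (\<lambda>z. G z (a + b)) (at x) v = frechet_derivative (\<lambda>z. G z a) (at x) v + frechet_derivative (\<lambda>z. G z b) (at x) v"
    using has_derivative_unique[OF D] by metis
  have "((\<lambda>z. G z (r *\<^sub>R a)) has_derivative (\<lambda>v. r *\<^sub>R frechet_derivative (\<lambda>z. G z a) (at x) v)) (at x)"
    by (rule has_derivative_transform_within_open[OF has_derivative_scaleR_right[OF D] assms(1,2)])
      (simp add: assms(3) linear_cmul)
  then show "frechet_derivative (\<lambda>z. G z (r *\<^sub>R a)) (at x) v = r *\<^sub>R frechet_derivative (\<lambda>z. G z a) (at x) v"
    using has_derivative_unique[OF D] by metis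
qed

text \<open>
  An injective linear map on a finite-dimensional space is bounded below, and the lower bound
  survives a small perturbation: the basis expansion bounds the operator norm of \<open>P z - P x\<close> by
  the sum of its values on the basis, which tends to 0. Locally this bounds the inverses of \<open>P z\<close> uniformly.
\<close>
lemma linear_family_bounded_below:
  fixes P :: "'e::euclidean_space \<Rightarrow> 'f::euclidean_space \<Rightarrow> 'b::euclidean_space"
  assumes "open S" "x \<in> S" "\<And>z. z \<in> S \<Longrightarrow> linear (P z)" "inj (P x)"
    and c: "\<And>e. continuous_on S (\<lambda>z. P z e)"
  obtains m where "m > 0" "eventually (\<lambda>z. \<forall>e. m * norm e \<le> norm (P z e)) (at x)"
proof -
  obtain B where B: "B > 0" "\<And>e. B * norm e \<le> norm (P x e)"
    using linear_inj_bounded_below_pos[OF assms(3)[OF assms(2)] assms(4)] by metis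
  have "((\<lambda>z. \<Sum>i\<in>Basis. norm (P z i - P x i)) \<longlongrightarrow> (\<Sum>i\<in>Basis. norm (P x i - P x i))) (at x)"
    using c assms(1,2) by (intro tendsto_intros) (auto simp: continuous_on_eq_continuous_at isCont_def)
  then have "eventually (\<lambda>z. (\<Sum>i\<in>Basis. norm (P z i - P x i)) < B / 2) (at x)"
    using B(1) by (intro order_tendstoD) auto
  moreover have "eventually (\<lambda>z. z \<in> S) (at x)"
    using assms(1,2) by (metis eventually_at_topological)
  ultimately have "eventually (\<lambda>z. \<forall>e. B / 2 * norm e \<le> norm (P z e)) (at x)"
  proof eventually_elim
    case (elim z)
    show ?case
    proof
      fix e
      have "norm (P z e - P x e) = norm (\<Sum>i\<in>Basis. (e \<bullet> i) *\<^sub>R (P z i - P x i))"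
      proof -
        have "P w e = (\<Sum>i\<in>Basis. (e \<bullet> i) *\<^sub>R P w i)" if "w \<in> S" for w
          using assms(3)[OF that] by (rule linear_Basis_expansion)
        then show ?thesis using elim(2) assms(2) by (simp add: sum_subtractf scaleR_diff_right)
      qed
      also have "\<dots> \<le> (\<Sum>i\<in>Basis. norm e * norm (P z i - P x i))"
        by (rule sum_norm_le) (auto intro!: mult_right_mono Basis_le_norm)
      also have "\<dots> \<le> norm e * (B / 2)"
        unfolding sum_distrib_left[symmetric] using elim(1) by (intro mult_left_mono) auto
      finally have "norm (P z e - P x e) \<le> norm e * (B / 2)" .
      moreover have "norm (P x e) \<le> norm (P z e) + norm (P z e - P x e)"
        using norm_triangle_ineq4[of "P z e" "P z e - P x e"] by simp
      ultimately show "B / 2 * norm e \<le> norm (P z e)"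
        using B(2)[of e] by (simp add: algebra_simps)
    qed
  qed
  then show ?thesis using that[of "B / 2"] B(1) by simp
qed

text \<open>
  Since \<open>P z (b z - b x) = q z - P z (b x)\<close>, the uniform lower bound turns convergence of the
  right-hand side to 0 into convergence of \<open>b z\<close> to \<open>b x\<close>.
\<close>
lemma continuous_on_solution:
  fixes P :: "'e::euclidean_space \<Rightarrow> 'f::euclidean_space \<Rightarrow> 'b::euclidean_space"
  assumes "open S" "\<And>z. z \<in> S \<Longrightarrow> linear (P z)" "\<And>z. z \<in> S \<Longrightarrow> inj (P z)"
    and c: "\<And>e. continuous_on S (\<lambda>z. P z e)" "continuous_on S q"
    and sol: "\<And>z. z \<in> S \<Longrightarrow> P z (b z) = q z"
  shows "continuous_on S b"
  unfolding continuous_on_eq_continuous_at[OF assms(1)]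
proof
  fix x assume x: "x \<in> S"
  obtain m where m: "m > 0" "eventually (\<lambda>z. \<forall>e. m * norm e \<le> norm (P z e)) (at x)"
    using linear_family_bounded_below[of S x P] assms x by blast
  have "((\<lambda>z. norm (q z - P z (b x)) / m) \<longlongrightarrow> norm (q x - P x (b x)) / m) (at x)"
    using c assms(1) x m(1) by (intro tendsto_intros) (auto simp: continuous_on_eq_continuous_at isCont_def)
  then have "((\<lambda>z. norm (q z - P z (b x)) / m) \<longlongrightarrow> 0) (at x)"
    using sol[OF x] by simp
  moreover have "eventually (\<lambda>z. norm (b z - b x) \<le> norm (q z - P z (b x)) / m) (at x)"
  proof -
    have "eventually (\<lambda>z. z \<in> S) (at x)"
      using assms(1) x by (metis eventually_at_topological)
    with m(2) show ?thesis
    proof eventually_elim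
      case (elim z)
      have "m * norm (b z - b x) \<le> norm (P z (b z - b x))" using elim by blast
      then show ?case
        using elim(2) m(1) assms(2)[of z] sol[of z] by (simp add: linear_diff field_simps)
    qed
  qed
  ultimately have "((\<lambda>z. norm (b z - b x)) \<longlongrightarrow> 0) (at x)"
    by (intro Lim_null_comparison[of "\<lambda>z. norm (b z - b x)"]) auto
  then show "isCont b x"
    by (simp add: isCont_def tendsto_norm_zero_iff LIM_zero_iff)
qed

text \<open>
  Formal differentiation of \<open>P z (b z) = q z\<close> determines the only candidate \<open>b'\<close>. It is the derivative
  because \<open>P z\<close> maps the error \<open>b z - b x - b' (z - x)\<close> to a function whose derivative at \<open>x\<close>
  vanishes, and the lower bound on \<open>P z\<close> transfers this back to the error.
\<close>
lemma has_derivative_solution: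
  fixes P :: "'e::euclidean_space \<Rightarrow> 'f::euclidean_space \<Rightarrow> 'f"
  assumes "open S" "x \<in> S" "\<And>z. z \<in> S \<Longrightarrow> linear (P z)" "\<And>z. z \<in> S \<Longrightarrow> inj (P z)"
    and P': "\<And>e. ((\<lambda>z. P z e) has_derivative (\<lambda>v. P' v e)) (at x)"
    and c: "\<And>e. continuous_on S (\<lambda>z. P z e)"
    and q': "(q has_derivative q') (at x)"
    and sol: "\<And>z. z \<in> S \<Longrightarrow> P z (b z) = q z"
  obtains b' where "(b has_derivative b') (at x)" "\<And>v. P x (b' v) = q' v - P' v (b x)"
proof -
  obtain g where g: "linear g" "\<And>e. P x (g e) = e"
    using linear_injective_isomorphism[OF assms(3,4)[OF assms(2)]] by blast
  define r' where "r' = (\<lambda>v. q' v - P' v (b x))"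
  define b' where "b' = (\<lambda>v. g (r' v))"
  have r: "((\<lambda>z. q z - P z (b x)) has_derivative r') (at x)"
    unfolding r'_def by (intro has_derivative_diff q' P')
  have bl: "bounded_linear b'"
    unfolding b'_def using bounded_linear_compose[OF linear_conv_bounded_linear[THEN iffD1, OF g(1)] has_derivative_bounded_linear[OF r]]
    by (simp add: o_def)
  have "((\<lambda>z. b' (z - x)) has_derivative b') (at x)"
    using bounded_linear.has_derivative[OF bl has_derivative_diff[OF has_derivative_ident has_derivative_const]] by simp
  from has_derivative_linear_family[OF assms(1,2,3) P' this]
  have "((\<lambda>z. P z (b' (z - x))) has_derivative (\<lambda>v. P x (b' v) + P' v (b' 0))) (at x)"
    by simp
  moreover have "P' v (b' 0) = 0" for v
  proof -
    have "((\<lambda>z. P z 0) has_derivative (\<lambda>v. 0)) (at x)"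
      by (rule has_derivative_transform_within_open[OF has_derivative_const assms(1,2)])
        (simp add: assms(3) linear_0)
    then have "P' v 0 = 0" using has_derivative_unique[OF P'] by metis
    moreover have "b' 0 = 0" using bl by (simp add: linear_0 bounded_linear.linear)
    ultimately show ?thesis by simp
  qed
  moreover have Pb: "P x (b' v) = r' v" for v by (simp add: b'_def g(2))
  ultimately have "((\<lambda>z. P z (b' (z - x))) has_derivative r') (at x)" by simp
  from has_derivative_diff[OF r this]
  \<comment> \<open>This is the image of the error under P z, since P z (b z) = q z.\<close>
  have w: "((\<lambda>z. q z - P z (b x) - P z (b' (z - x))) has_derivative (\<lambda>v. 0)) (at x)" by simp
  obtain m where m: "m > 0" "eventually (\<lambda>z. \<forall>e. m * norm e \<le> norm (P z e)) (at x)"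
    using linear_family_bounded_below[of S x P] assms by blast
  have b'0: "b' 0 = 0" using bl by (simp add: linear_0 bounded_linear.linear)
  have "((\<lambda>z. norm (q z - P z (b x) - P z (b' (z - x))) / norm (z - x)) \<longlongrightarrow> 0) (at x)"
    using w b'0 sol[OF assms(2)] assms(3)[OF assms(2)] by (simp add: has_derivative_iff_norm linear_0)
  then have "((\<lambda>z. norm (b z - b x - b' (z - x)) / norm (z - x)) \<longlongrightarrow> 0) (at x)"
  proof (rule tendsto_0_le[where K = "1 / m"])
    have "eventually (\<lambda>z. z \<in> S) (at x)"
      using assms(1,2) by (metis eventually_at_topological)
    with m(2) show "eventually (\<lambda>z. norm (norm (b z - b x - b' (z - x)) / norm (z - x)) \<le>
      norm (norm (q z - P z (b x) - P z (b' (z - x))) / norm (z - x)) * (1 / m)) (at x)"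
    proof eventually_elim
      case (elim z)
      have "m * norm (b z - b x - b' (z - x)) \<le> norm (P z (b z - b x - b' (z - x)))"
        using elim by blast
      also have "P z (b z - b x - b' (z - x)) = q z - P z (b x) - P z (b' (z - x))"
        using elim(2) assms(3)[of z] sol[of z] by (simp add: linear_diff)
      finally have "norm (b z - b x - b' (z - x)) \<le> norm (q z - P z (b x) - P z (b' (z - x))) * (1 / m)"
        using m(1) by (simp add: field_simps)
      from divide_right_mono[OF this, of "norm (z - x)"] show ?case
        using m(1) by (simp add: mult.commute)
    qed
  qed
  then have "(b has_derivative b') (at x)"
    using bl by (simp add: has_derivative_iff_norm)
  then show ?thesis using that[of b'] Pb r'_def by simp
qed

text \<open>
  The derivative of a solution solves a linear system with the same matrix \<open>P\<close> and a right-hand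
  side of one class less, so the induction on \<open>k\<close> must allow every right-hand side.
\<close>
lemma Ck_on_solution:
  fixes P :: "'e::euclidean_space \<Rightarrow> 'f::euclidean_space \<Rightarrow> 'f"
  assumes "open S" "\<And>z. z \<in> S \<Longrightarrow> linear (P z)" "\<And>z. z \<in> S \<Longrightarrow> inj (P z)"
    and "\<And>e. Ck_on k S (\<lambda>z. P z e)" "Ck_on k S q" "\<And>z. z \<in> S \<Longrightarrow> P z (b z) = q z"
  shows "Ck_on k S b"
  using assms(4-)
proof (induction k arbitrary: q b)
  case 0
  show ?case
    using continuous_on_solution[of S P q b] assms(1-3) 0 by simp
next
  case (Suc k)
  let ?P' = "\<lambda>z v e. frechet_derivative (\<lambda>z. P z e) (at z) v"
  let ?q' = "\<lambda>z. frechet_derivative q (at z)"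
  have "\<exists>b'. (b has_derivative b') (at x) \<and> (\<forall>v. P x (b' v) = ?q' x v - ?P' x v (b x))" if "x \<in> S" for x
  proof (rule has_derivative_solution[OF assms(1) that assms(2,3), where P' = "?P' x" and q = q and q' = "?q' x" and b = b])
    show "((\<lambda>z. P z e) has_derivative (\<lambda>v. ?P' x v e)) (at x)" for e
      by (rule Ck_on_SucD_derivative[OF Suc.prems(1) that])
    show "continuous_on S (\<lambda>z. P z e)" for e
      by (rule Ck_on_continuous[OF Suc.prems(1)])
    show "(q has_derivative ?q' x) (at x)"
      by (rule Ck_on_SucD_derivative[OF Suc.prems(2) that])
  qed (use Suc.prems(3) in blast)+
  then obtain b' where b': "\<And>x. x \<in> S \<Longrightarrow> (b has_derivative b' x) (at x)"
    "\<And>x v. x \<in> S \<Longrightarrow> P x (b' x v) = ?q' x v - ?P' x v (b x)" by metis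
  have b: "Ck_on k S b"
    by (rule Suc.IH[OF Ck_on_SucD[OF Suc.prems(1)] Ck_on_SucD[OF Suc.prems(2)] Suc.prems(3)])
  have "Ck_on k S (\<lambda>z. b' z v)" for v
  proof (rule Suc.IH[OF Ck_on_SucD[OF Suc.prems(1)] _ b'(2)])
    have "Ck_on k S (\<lambda>z. ?P' z v (b z))"
    proof (rule Ck_on_linear_family[OF assms(1) _ _ b])
      show "linear (?P' z v)" if "z \<in> S" for z
        by (rule linear_family_derivative_linear[OF assms(1) that assms(2)]) (use Suc.prems(1) that in auto)
      show "Ck_on k S (\<lambda>z. ?P' z v e)" for e using Suc.prems(1)[of e] by simp
    qed
    moreover have "Ck_on k S (\<lambda>z. ?q' z v)" using Suc.prems(2) by simp
    ultimately show "Ck_on k S (\<lambda>z. ?q' z v - ?P' z v (b z))" by (intro Ck_on_diff assms(1))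
  qed
  with b'(1) show ?case by (rule Ck_on_SucI[OF assms(1)])
qed

section \<open>Symmetry of second derivatives\<close>

text \<open>
  The mean value theorem is applied twice, first in the direction \<open>u\<close> and then in the direction \<open>v\<close>.
  The left-hand side is symmetric in \<open>u\<close> and \<open>v\<close>, which is the reason for Schwarz's theorem below.
\<close>
lemma mixed_second_difference:
  fixes F :: "'e::euclidean_space \<Rightarrow> real"
  assumes "open S" "Ck_on 2 S F" "h > 0"
    and in_S: "\<And>s t. 0 \<le> s \<Longrightarrow> s \<le> h \<Longrightarrow> 0 \<le> t \<Longrightarrow> t \<le> h \<Longrightarrow> z + s *\<^sub>R u + t *\<^sub>R v \<in> S"
  obtains s t where "0 < s" "s < h" "0 < t" "t < h"
    "F (z + h *\<^sub>R u + h *\<^sub>R v) - F (z + h *\<^sub>R u) - F (z + h *\<^sub>R v) + F z =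
      h * h * frechet_derivative (\<lambda>x. frechet_derivative F (at x) u) (at (z + s *\<^sub>R u + t *\<^sub>R v)) v"
proof -
  let ?Fu = "\<lambda>x. frechet_derivative F (at x) u"
  have F: "Ck_on (Suc (Suc 0)) S F" using assms(2) by (simp only: numeral_2_eq_2)
  then have Fu: "Ck_on (Suc 0) S ?Fu" by simp
  have dF: "((\<lambda>s. F (z + s *\<^sub>R u + t *\<^sub>R v)) has_real_derivative ?Fu (z + s *\<^sub>R u + t *\<^sub>R v)) (at s)"
    if "0 \<le> s" "s \<le> h" "0 \<le> t" "t \<le> h" for s t
  proof -
    have D: "(F has_derivative frechet_derivative F (at (z + s *\<^sub>R u + t *\<^sub>R v))) (at (z + s *\<^sub>R u + t *\<^sub>R v))"
      by (rule Ck_on_SucD_derivative[OF F in_S[OF that]])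
    have "((\<lambda>s. z + s *\<^sub>R u + t *\<^sub>R v) has_derivative (\<lambda>d. d *\<^sub>R u)) (at s)"
      by (auto intro!: derivative_eq_intros)
    from has_derivative_compose[OF this D] linear_cmul[OF has_derivative_linear[OF D]]
    show ?thesis by (simp add: has_field_derivative_def mult_commute_abs)
  qed
  have dFu: "((\<lambda>t. ?Fu (z + s *\<^sub>R u + t *\<^sub>R v)) has_real_derivative frechet_derivative ?Fu (at (z + s *\<^sub>R u + t *\<^sub>R v)) v) (at t)"
    if "0 \<le> s" "s \<le> h" "0 \<le> t" "t \<le> h" for s t
  proof -
    have D: "(?Fu has_derivative frechet_derivative ?Fu (at (z + s *\<^sub>R u + t *\<^sub>R v))) (at (z + s *\<^sub>R u + t *\<^sub>R v))"
      by (rule Ck_on_SucD_derivative[OF Fu in_S[OF that]])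
    have "((\<lambda>t. z + s *\<^sub>R u + t *\<^sub>R v) has_derivative (\<lambda>d. d *\<^sub>R v)) (at t)"
      by (auto intro!: derivative_eq_intros)
    from has_derivative_compose[OF this D] linear_cmul[OF has_derivative_linear[OF D]]
    show ?thesis by (simp add: has_field_derivative_def mult_commute_abs)
  qed
  define \<phi> where "\<phi> = (\<lambda>s. F (z + s *\<^sub>R u + h *\<^sub>R v) - F (z + s *\<^sub>R u + 0 *\<^sub>R v))"
  have "\<exists>s. 0 < s \<and> s < h \<and> \<phi> h - \<phi> 0 = (h - 0) * (?Fu (z + s *\<^sub>R u + h *\<^sub>R v) - ?Fu (z + s *\<^sub>R u + 0 *\<^sub>R v))"
    unfolding \<phi>_def using assms(3) by (intro MVT2 DERIV_diff dF) auto
  then obtain s where s: "0 < s" "s < h"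
    "\<phi> h - \<phi> 0 = h * (?Fu (z + s *\<^sub>R u + h *\<^sub>R v) - ?Fu (z + s *\<^sub>R u + 0 *\<^sub>R v))" by auto
  have "\<exists>t. 0 < t \<and> t < h \<and> ?Fu (z + s *\<^sub>R u + h *\<^sub>R v) - ?Fu (z + s *\<^sub>R u + 0 *\<^sub>R v) =
      (h - 0) * frechet_derivative ?Fu (at (z + s *\<^sub>R u + t *\<^sub>R v)) v"
    using assms(3) s by (intro MVT2 dFu) auto
  then obtain t where t: "0 < t" "t < h"
    "?Fu (z + s *\<^sub>R u + h *\<^sub>R v) - ?Fu (z + s *\<^sub>R u + 0 *\<^sub>R v) = h * frechet_derivative ?Fu (at (z + s *\<^sub>R u + t *\<^sub>R v)) v"
    by auto
  show ?thesis
    by (rule that[OF s(1,2) t(1,2)]) (use s(3) t(3) in \<open>simp add: \<phi>_def algebra_simps\<close>)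
qed

lemma symmetric_second_derivative_real:
  fixes F :: "'e::euclidean_space \<Rightarrow> real"
  assumes "open S" "Ck_on 2 S F" "z \<in> S"
  shows "frechet_derivative (\<lambda>x. frechet_derivative F (at x) u) (at z) v =
    frechet_derivative (\<lambda>x. frechet_derivative F (at x) v) (at z) u"
proof (rule ccontr)
  let ?D = "\<lambda>u v x. frechet_derivative (\<lambda>x. frechet_derivative F (at x) u) (at x) v"
  assume ne: "\<not> ?thesis"
  define \<epsilon> where "\<epsilon> = dist (?D u v z) (?D v u z) / 2"
  have \<epsilon>: "\<epsilon> > 0" "dist (?D u v z) (?D v u z) = 2 * \<epsilon>"
    using ne by (simp_all add: \<epsilon>_def)
  have "continuous_on S (?D u v)" "continuous_on S (?D v u)"
    using assms(2) by (simp_all add: numeral_2_eq_2)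
  then have "isCont (?D u v) z" "isCont (?D v u) z"
    using assms(1,3) by (simp_all add: continuous_on_eq_continuous_at)
  then obtain d1 d2 where d: "d1 > 0" "d2 > 0" "\<And>y. dist y z < d1 \<Longrightarrow> dist (?D u v y) (?D u v z) < \<epsilon>"
    "\<And>y. dist y z < d2 \<Longrightarrow> dist (?D v u y) (?D v u z) < \<epsilon>"
    unfolding continuous_at_eps_delta using \<epsilon>(1) by metis
  obtain d3 where d3: "d3 > 0" "ball z d3 \<subseteq> S" using assms(1,3) openE by blast
  define \<delta> where "\<delta> = min d1 (min d2 d3)"
  \<comment> \<open>The step h keeps the parallelogram spanned by h u and h v inside the ball of radius \<open>\<delta>\<close>.\<close>
  define N where "N = norm u + norm v + 1"
  define h where "h = \<delta> / 2 / N"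
  have \<delta>: "\<delta> > 0" "\<delta> \<le> d1" "\<delta> \<le> d2" "\<delta> \<le> d3" using d d3 by (auto simp: \<delta>_def)
  have npos: "N > 0" by (simp add: N_def add_nonneg_pos)
  have h: "h > 0" using \<delta> npos by (simp add: h_def)
  have near: "dist (z + s *\<^sub>R u + t *\<^sub>R v) z < \<delta>" if "0 \<le> s" "s \<le> h" "0 \<le> t" "t \<le> h" for s t
  proof -
    have "dist (z + s *\<^sub>R u + t *\<^sub>R v) z = norm (s *\<^sub>R u + t *\<^sub>R v)"
      by (simp add: dist_norm algebra_simps)
    also have "\<dots> \<le> s * norm u + t * norm v"
      using norm_triangle_ineq[of "s *\<^sub>R u" "t *\<^sub>R v"] that by simp
    also have "\<dots> \<le> h * norm u + h * norm v"
      using that by (intro add_mono mult_right_mono) auto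
    also have "\<dots> \<le> h * N" using h by (simp add: N_def algebra_simps)
    also have "\<dots> = \<delta> / 2" using npos by (simp add: h_def)
    finally show ?thesis using \<delta> by simp
  qed
  have inS: "z + s *\<^sub>R u + t *\<^sub>R v \<in> S" if "0 \<le> s" "s \<le> h" "0 \<le> t" "t \<le> h" for s t
    using near[OF that] d3 \<delta>(4) by (auto simp: dist_commute subset_eq)
  have inS': "z + t *\<^sub>R v + s *\<^sub>R u \<in> S" if "0 \<le> t" "t \<le> h" "0 \<le> s" "s \<le> h" for s t
    using inS[OF that(3,4,1,2)] by (simp add: add_ac)
  obtain s t where st: "0 < s" "s < h" "0 < t" "t < h"
    "F (z + h *\<^sub>R u + h *\<^sub>R v) - F (z + h *\<^sub>R u) - F (z + h *\<^sub>R v) + F z = h * h * ?D u v (z + s *\<^sub>R u + t *\<^sub>R v)"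
    by (rule mixed_second_difference[OF assms(1,2) h inS])
  obtain t' s' where st': "0 < t'" "t' < h" "0 < s'" "s' < h"
    "F (z + h *\<^sub>R v + h *\<^sub>R u) - F (z + h *\<^sub>R v) - F (z + h *\<^sub>R u) + F z = h * h * ?D v u (z + t' *\<^sub>R v + s' *\<^sub>R u)"
    by (rule mixed_second_difference[OF assms(1,2) h inS'])
  have "h * h * ?D u v (z + s *\<^sub>R u + t *\<^sub>R v) = h * h * ?D v u (z + s' *\<^sub>R u + t' *\<^sub>R v)"
    using st(5) st'(5) by (simp add: algebra_simps)
  then have "?D u v (z + s *\<^sub>R u + t *\<^sub>R v) = ?D v u (z + s' *\<^sub>R u + t' *\<^sub>R v)" using h by simp
  moreover have "dist (?D u v (z + s *\<^sub>R u + t *\<^sub>R v)) (?D u v z) < \<epsilon>"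
    using near[of s t] st \<delta> by (intro d) auto
  moreover have "dist (?D v u (z + s' *\<^sub>R u + t' *\<^sub>R v)) (?D v u z) < \<epsilon>"
    using near[of s' t'] st' \<delta> by (intro d) auto
  ultimately show False
    using \<epsilon>(2) by (smt (verit) dist_real_def)
qed

lemma symmetric_second_derivative:
  fixes F :: "'e::euclidean_space \<Rightarrow> 'b::euclidean_space"
  assumes "open S" "Ck_on 2 S F" "z \<in> S"
  shows "frechet_derivative (\<lambda>x. frechet_derivative F (at x) u) (at z) v =
    frechet_derivative (\<lambda>x. frechet_derivative F (at x) v) (at z) u"
proof (rule euclidean_eqI)
  fix i :: 'b assume "i \<in> Basis"
  have F: "Ck_on (Suc (Suc 0)) S F" using assms(2) by (simp only: numeral_2_eq_2)
  have 1: "frechet_derivative (\<lambda>x. F x \<bullet> i) (at x) = (\<lambda>w. frechet_derivative F (at x) w \<bullet> i)" if "x \<in> S" for x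
    using has_derivative_inner_left[OF Ck_on_SucD_derivative[OF F that]] frechet_derivative_at by metis
  have 2: "frechet_derivative (\<lambda>x. frechet_derivative (\<lambda>x. F x \<bullet> i) (at x) u) (at z) v =
      frechet_derivative (\<lambda>x. frechet_derivative F (at x) u) (at z) v \<bullet> i" for u v
  proof -
    have "Ck_on (Suc 0) S (\<lambda>x. frechet_derivative F (at x) u)" using F by simp
    note D = has_derivative_inner_left[OF Ck_on_SucD_derivative[OF this assms(3)], of i]
    have "frechet_derivative (\<lambda>x. frechet_derivative (\<lambda>x. F x \<bullet> i) (at x) u) (at z) =
        frechet_derivative (\<lambda>x. frechet_derivative F (at x) u \<bullet> i) (at z)"
      by (rule frechet_derivative_cong_open[OF assms(1,3)]) (simp add: 1)
    then show ?thesis using frechet_derivative_at[OF D] by metis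
  qed
  have "Ck_on 2 S (\<lambda>x. F x \<bullet> i)"
    by (rule Ck_on_bounded_linear_comp[OF assms(1) bounded_linear_inner_left assms(2)])
  from symmetric_second_derivative_real[OF assms(1) this assms(3)] 2
  show "frechet_derivative (\<lambda>x. frechet_derivative F (at x) u) (at z) v \<bullet> i =
    frechet_derivative (\<lambda>x. frechet_derivative F (at x) v) (at z) u \<bullet> i"
    by metis
qed

section \<open>Smooth maps\<close>

lemma smooth_on_derivative:
  assumes "smooth_on S f"
  shows "smooth_on S (\<lambda>x. frechet_derivative f (at x) v)"
  using assms unfolding smooth_on_def by (metis Ck_on.simps(2))

lemma smooth_on_has_derivative:
  assumes "smooth_on S f" "x \<in> S"
  shows "(f has_derivative frechet_derivative f (at x)) (at x)"
  using assms unfolding smooth_on_def by (blast intro: Ck_on_SucD_derivative)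

lemma smooth_on_cong: "open S \<Longrightarrow> (\<And>y. y \<in> S \<Longrightarrow> f y = g y) \<Longrightarrow> smooth_on S f \<Longrightarrow> smooth_on S g"
  unfolding smooth_on_def by (blast intro: Ck_on_cong)

lemma smooth_on_const: "open S \<Longrightarrow> smooth_on S (\<lambda>x. a)"
  unfolding smooth_on_def by (blast intro: Ck_on_const)

lemma smooth_on_bounded_linear: "open S \<Longrightarrow> bounded_linear l \<Longrightarrow> smooth_on S l"
  unfolding smooth_on_def by (blast intro: Ck_on_bounded_linear)

lemma smooth_on_bounded_linear_comp:
  "open S \<Longrightarrow> bounded_linear l \<Longrightarrow> smooth_on S f \<Longrightarrow> smooth_on S (\<lambda>x. l (f x))"
  unfolding smooth_on_def by (blast intro: Ck_on_bounded_linear_comp)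

lemma smooth_on_compose_linear:
  assumes "open S" "open T" "bounded_linear l" "l ` T \<subseteq> S" "smooth_on S f"
  shows "smooth_on T (\<lambda>x. f (l x))"
  using assms unfolding smooth_on_def by (blast intro: Ck_on_compose_linear)

lemma smooth_on_add: "open S \<Longrightarrow> smooth_on S f \<Longrightarrow> smooth_on S g \<Longrightarrow> smooth_on S (\<lambda>x. f x + g x)"
  unfolding smooth_on_def by (blast intro: Ck_on_add)

lemma smooth_on_minus: "open S \<Longrightarrow> smooth_on S f \<Longrightarrow> smooth_on S (\<lambda>x. - f x)"
  unfolding smooth_on_def by (blast intro: Ck_on_minus)

lemma smooth_on_diff: "open S \<Longrightarrow> smooth_on S f \<Longrightarrow> smooth_on S g \<Longrightarrow> smooth_on S (\<lambda>x. f x - g x)"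
  unfolding smooth_on_def by (blast intro: Ck_on_diff)

lemma smooth_on_linear_family:
  fixes G :: "'e::euclidean_space \<Rightarrow> 'f::euclidean_space \<Rightarrow> 'b::real_normed_vector"
  assumes "open S" "\<And>z. z \<in> S \<Longrightarrow> linear (G z)" "\<And>e. smooth_on S (\<lambda>z. G z e)" "smooth_on S h"
  shows "smooth_on S (\<lambda>z. G z (h z))"
  using assms unfolding smooth_on_def by (blast intro: Ck_on_linear_family)

lemma smooth_on_solution:
  fixes P :: "'e::euclidean_space \<Rightarrow> 'f::euclidean_space \<Rightarrow> 'f"
  assumes "open S" "\<And>z. z \<in> S \<Longrightarrow> linear (P z)" "\<And>z. z \<in> S \<Longrightarrow> inj (P z)"
    and "\<And>e. smooth_on S (\<lambda>z. P z e)" "smooth_on S q" "\<And>z. z \<in> S \<Longrightarrow> P z (b z) = q z"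
  shows "smooth_on S b"
  unfolding smooth_on_def
proof
  fix k show "Ck_on k S b"
    using assms(4,5) by (intro Ck_on_solution[where P = P and q = q, OF assms(1-3) _ _ assms(6)]) (auto simp: smooth_on_def)
qed

lemma smooth_on_Pair:
  fixes f :: "'e::euclidean_space \<Rightarrow> 'b::real_normed_vector" and g :: "'e \<Rightarrow> 'c::real_normed_vector"
  assumes "open S" "smooth_on S f" "smooth_on S g"
  shows "smooth_on S (\<lambda>x. (f x, g x))"
proof -
  have "smooth_on S (\<lambda>x. (f x, 0) + (0, g x))"
    by (intro smooth_on_add smooth_on_bounded_linear_comp[of S "\<lambda>a. (a, 0)"]
        smooth_on_bounded_linear_comp[of S "\<lambda>a. (0, a)"] assms
        bounded_linear_Pair bounded_linear_ident bounded_linear_zero)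
  then show ?thesis by simp
qed

section \<open>Tangent vectors and vector fields on a manifold\<close>

text \<open>
  The calculus of tangent vectors rests on these properties of coordinate changes. Both the given
  atlas and the induced atlas of the slit bundle are instances, so that tangent vectors, derivations
  and Lie brackets are treated once for both.
\<close>
locale smooth_atlas =
  fixes \<A> :: "('a, 'e::euclidean_space) chart set"
  assumes inj_chart: "c \<in> \<A> \<Longrightarrow> inj_on (snd c) (fst c)"
    and open_overlap: "c \<in> \<A> \<Longrightarrow> d \<in> \<A> \<Longrightarrow> open (snd c ` (fst c \<inter> fst d))"
    and smooth_transition: "c \<in> \<A> \<Longrightarrow> d \<in> \<A> \<Longrightarrow>
      smooth_on (snd c ` (fst c \<inter> fst d)) (snd d \<circ> chart_inv c)"
begin

abbreviation overlap :: "('a, 'e) chart \<Rightarrow> ('a, 'e) chart \<Rightarrow> 'e set" where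
  "overlap c d \<equiv> snd c ` (fst c \<inter> fst d)"

abbreviation transition :: "('a, 'e) chart \<Rightarrow> ('a, 'e) chart \<Rightarrow> 'e \<Rightarrow> 'e" where
  "transition c d \<equiv> snd d \<circ> chart_inv c"

abbreviation jacobian :: "('a, 'e) chart \<Rightarrow> ('a, 'e) chart \<Rightarrow> 'e \<Rightarrow> 'e \<Rightarrow> 'e" where
  "jacobian c d z \<equiv> frechet_derivative (transition c d) (at z)"

abbreviation local_rep :: "('a, 'e) chart \<Rightarrow> ('a \<Rightarrow> ('a, 'e) tvec) \<Rightarrow> 'e \<Rightarrow> 'e" where
  "local_rep c Y \<equiv> (\<lambda>z. Y (chart_inv c z) c)"

lemma chart_inv_chart [simp]: "c \<in> \<A> \<Longrightarrow> p \<in> fst c \<Longrightarrow> chart_inv c (snd c p) = p"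
  unfolding chart_inv_def using inj_chart by (simp add: inv_into_f_f)

lemma
  assumes "c \<in> \<A>" "z \<in> chart_image c"
  shows chart_inv_mem: "chart_inv c z \<in> fst c"
    and chart_chart_inv: "snd c (chart_inv c z) = z"
  using assms unfolding chart_image_def chart_inv_def by (auto simp: inv_into_into f_inv_into_f)

lemma open_chart_image: "c \<in> \<A> \<Longrightarrow> open (chart_image c)"
  using open_overlap[of c c] by (simp add: chart_image_def)

lemma chart_mem_image: "p \<in> fst c \<Longrightarrow> snd c p \<in> chart_image c"
  by (simp add: chart_image_def)

lemma carrierI: "c \<in> \<A> \<Longrightarrow> p \<in> fst c \<Longrightarrow> p \<in> carrier \<A>"
  by (auto simp: carrier_def)

lemma carrierE: assumes "p \<in> carrier \<A>" obtains c where "c \<in> \<A>" "p \<in> fst c"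
  using assms by (auto simp: carrier_def)

lemma transition_has_derivative:
  assumes "c \<in> \<A>" "d \<in> \<A>" "p \<in> fst c" "p \<in> fst d"
  shows "(transition c d has_derivative jacobian c d (snd c p)) (at (snd c p))"
  using assms by (intro smooth_on_has_derivative[OF smooth_transition]) auto

lemma linear_jacobian:
  assumes "c \<in> \<A>" "d \<in> \<A>" "p \<in> fst c" "p \<in> fst d"
  shows "linear (jacobian c d (snd c p))"
  by (rule has_derivative_linear[OF transition_has_derivative[OF assms]])

lemma jacobian_self:
  assumes "c \<in> \<A>" "p \<in> fst c"
  shows "jacobian c c (snd c p) v = v"
proof -
  have "jacobian c c (snd c p) = frechet_derivative (\<lambda>z. z) (at (snd c p))"
    by (rule frechet_derivative_cong_open[OF open_chart_image[OF assms(1)] chart_mem_image[OF assms(2)]])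
      (simp add: chart_chart_inv assms)
  then show ?thesis by simp
qed

lemma jacobian_compose:
  assumes "c \<in> \<A>" "d \<in> \<A>" "e \<in> \<A>" "p \<in> fst c" "p \<in> fst d" "p \<in> fst e"
  shows "jacobian d e (snd d p) (jacobian c d (snd c p) v) = jacobian c e (snd c p) v"
proof -
  have z: "transition c d (snd c p) = snd d p" using assms by simp
  have "((\<lambda>z. transition d e (transition c d z)) has_derivative
      (\<lambda>v. jacobian d e (snd d p) (jacobian c d (snd c p) v))) (at (snd c p))"
    using has_derivative_compose[OF transition_has_derivative[OF assms(1,2,4,5)], of "transition d e"]
      transition_has_derivative[OF assms(2,3,5,6)] z by simp
  then have "(transition c e has_derivative (\<lambda>v. jacobian d e (snd d p) (jacobian c d (snd c p) v))) (at (snd c p))"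
    by (rule has_derivative_transform_within_open[OF _ open_overlap[OF assms(1,2)]])
      (use assms in auto)
  from has_derivative_unique[OF this transition_has_derivative[OF assms(1,3,4,6)]]
  show ?thesis by metis
qed

lemma tangent_spaceI:
  assumes "\<And>c. \<not> (c \<in> \<A> \<and> p \<in> fst c) \<Longrightarrow> v c = 0"
    and "\<And>c d. c \<in> \<A> \<Longrightarrow> d \<in> \<A> \<Longrightarrow> p \<in> fst c \<Longrightarrow> p \<in> fst d \<Longrightarrow> v d = jacobian c d (snd c p) (v c)"
  shows "v \<in> tangent_space \<A> p"
  using assms unfolding tangent_space_def by blast

lemma tangent_space_outside: "v \<in> tangent_space \<A> p \<Longrightarrow> \<not> (c \<in> \<A> \<and> p \<in> fst c) \<Longrightarrow> v c = 0"
  unfolding tangent_space_def by blast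

lemma tangent_space_transition:
  "v \<in> tangent_space \<A> p \<Longrightarrow> c \<in> \<A> \<Longrightarrow> d \<in> \<A> \<Longrightarrow> p \<in> fst c \<Longrightarrow> p \<in> fst d \<Longrightarrow>
    v d = jacobian c d (snd c p) (v c)"
  unfolding tangent_space_def by blast

lemma coord_vec_tangent:
  assumes "c \<in> \<A>" "p \<in> fst c"
  shows "coord_vec \<A> c e p \<in> tangent_space \<A> p"
  using assms jacobian_compose[of c] by (intro tangent_spaceI) (auto simp: coord_vec_def)

lemma coord_vec_component:
  assumes "c \<in> \<A>" "p \<in> fst c"
  shows "coord_vec \<A> c e p c = e"
  using assms jacobian_self[of c p] by (auto simp: coord_vec_def)

lemma tangent_eqI:
  assumes "v \<in> tangent_space \<A> p" "w \<in> tangent_space \<A> p" "c \<in> \<A>" "p \<in> fst c" "v c = w c"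
  shows "v = w"
proof
  fix d show "v d = w d"
    using tangent_space_transition[OF assms(1) assms(3), of d] tangent_space_transition[OF assms(2) assms(3), of d]
      tangent_space_outside[OF assms(1), of d] tangent_space_outside[OF assms(2), of d] assms(4,5) by metis
qed

lemma coord_vec_of_component:
  assumes "v \<in> tangent_space \<A> p" "c \<in> \<A>" "p \<in> fst c"
  shows "coord_vec \<A> c (v c) p = v"
  using assms by (intro tangent_eqI[of _ p _ c]) (simp_all add: coord_vec_tangent coord_vec_component)

lemma tangent_space_lincomb:
  assumes "v \<in> tangent_space \<A> p" "w \<in> tangent_space \<A> p"
  shows "a \<odot> v + b \<odot> w \<in> tangent_space \<A> p"
proof (rule tangent_spaceI)
  fix c d assume cd: "c \<in> \<A>" "d \<in> \<A>" "p \<in> fst c" "p \<in> fst d"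
  note J = linear_jacobian[OF cd]
  show "(a \<odot> v + b \<odot> w) d = jacobian c d (snd c p) ((a \<odot> v + b \<odot> w) c)"
    by (simp add: linear_add[OF J] linear_cmul[OF J]
        tangent_space_transition[OF assms(1) cd] tangent_space_transition[OF assms(2) cd])
qed (simp add: tangent_space_outside[OF assms(1)] tangent_space_outside[OF assms(2)])

lemma tangent_space_zero: "0 \<in> tangent_space \<A> p"
  by (intro tangent_spaceI) (simp_all add: linear_0[OF linear_jacobian])

lemma tangent_space_diff: "v \<in> tangent_space \<A> p \<Longrightarrow> w \<in> tangent_space \<A> p \<Longrightarrow> v - w \<in> tangent_space \<A> p"
  using tangent_space_lincomb[of v p w 1 "-1"] by (simp add: fun_diff_def plus_fun_def)

text \<open>
  The right-hand sides, here and in the next lemma, have the shape of the linear combinations in the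
  definition of a connection.
\<close>
lemma coord_vec_add:
  assumes "c \<in> \<A>" "p \<in> fst c"
  shows "coord_vec \<A> c (e + f) p = 1 \<odot> coord_vec \<A> c e p + 1 \<odot> coord_vec \<A> c f p"
  using assms
  by (intro tangent_eqI[of _ p _ c] tangent_space_lincomb) (simp_all add: coord_vec_tangent coord_vec_component)

lemma coord_vec_scale:
  assumes "c \<in> \<A>" "p \<in> fst c"
  shows "coord_vec \<A> c (r *\<^sub>R e) p = r \<odot> coord_vec \<A> c e p + 0 \<odot> coord_vec \<A> c e p"
  using assms
  by (intro tangent_eqI[of _ p _ c] tangent_space_lincomb) (simp_all add: coord_vec_tangent coord_vec_component)

lemma chart_at:
  assumes "p \<in> carrier \<A>"
  shows "chart_at \<A> p \<in> \<A>" "p \<in> fst (chart_at \<A> p)"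
  using someI_ex[of "\<lambda>c. c \<in> \<A> \<and> p \<in> fst c"] carrierE[OF assms] unfolding chart_at_def by blast+

text \<open>
  The definition of \<^const>\<open>deriv_along\<close> picks an arbitrary chart; by the chain rule every chart around
  the point gives the same value.
\<close>
lemma deriv_along_chart:
  assumes c: "c \<in> \<A>" "p \<in> fst c" and v: "v \<in> tangent_space \<A> p"
    and f: "(f \<circ> chart_inv c has_derivative f') (at (snd c p))"
  shows "deriv_along \<A> p v f = f' (v c)"
proof -
  define d where "d = chart_at \<A> p"
  have d: "d \<in> \<A>" "p \<in> fst d" using chart_at[OF carrierI[OF c]] by (simp_all add: d_def)
  have z: "transition d c (snd d p) = snd c p" using c d by simp
  have "((\<lambda>z. (f \<circ> chart_inv c) (transition d c z)) has_derivative (\<lambda>v. f' (jacobian d c (snd d p) v))) (at (snd d p))"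
    using has_derivative_compose[OF transition_has_derivative[OF d(1) c(1) d(2) c(2)], of "f \<circ> chart_inv c"] f z by simp
  then have "((f \<circ> chart_inv d) has_derivative (\<lambda>v. f' (jacobian d c (snd d p) v))) (at (snd d p))"
    by (rule has_derivative_transform_within_open[OF _ open_overlap[OF d(1) c(1)]])
      (use c d in auto)
  then have "frechet_derivative (f \<circ> chart_inv d) (at (snd d p)) (v d) = f' (jacobian d c (snd d p) (v d))"
    using frechet_derivative_at by metis
  then show ?thesis
    using tangent_space_transition[OF v d(1) c(1) d(2) c(2)] by (simp add: deriv_along_def d_def Let_def)
qed

definition vector_fields :: "('a \<Rightarrow> ('a, 'e) tvec) set" where
  "vector_fields = {X. (\<forall>p\<in>carrier \<A>. X p \<in> tangent_space \<A> p) \<and>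
     (\<forall>c\<in>\<A>. smooth_on (chart_image c) (local_rep c X))}"

lemma
  assumes "X \<in> vector_fields"
  shows vector_fields_tangent: "c \<in> \<A> \<Longrightarrow> p \<in> fst c \<Longrightarrow> X p \<in> tangent_space \<A> p"
    and vector_fields_smooth: "c \<in> \<A> \<Longrightarrow> smooth_on (chart_image c) (local_rep c X)"
  using assms carrierI by (auto simp: vector_fields_def)

lemma vector_fields_has_derivative:
  assumes "X \<in> vector_fields" "c \<in> \<A>" "p \<in> fst c"
  shows "(local_rep c X has_derivative frechet_derivative (local_rep c X) (at (snd c p))) (at (snd c p))"
  using smooth_on_has_derivative[OF vector_fields_smooth[OF assms(1,2)]] assms(3) by (simp add: chart_mem_image)

lemma lie_bracket_local_rep:
  assumes X: "X \<in> vector_fields" and Y: "Y \<in> vector_fields" and c: "c \<in> \<A>" "p \<in> fst c"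
  shows "lie_bracket \<A> X Y p c =
    frechet_derivative (local_rep c Y) (at (snd c p)) (X p c) - frechet_derivative (local_rep c X) (at (snd c p)) (Y p c)"
proof -
  have "deriv_along \<A> p (X p) (\<lambda>q. Y q c) = frechet_derivative (local_rep c Y) (at (snd c p)) (X p c)"
    if X: "X \<in> vector_fields" and Y: "Y \<in> vector_fields" for X Y
    by (rule deriv_along_chart[OF c vector_fields_tangent[OF X c]])
      (use vector_fields_has_derivative[OF Y c] in \<open>simp add: o_def\<close>)
  from this[OF X Y] this[OF Y X] show ?thesis using c by (simp add: lie_bracket_def)
qed

text \<open>
  In a new chart a vector field is \<open>Y\<^sub>d = J Y\<^sub>c\<close> with the Jacobian \<open>J\<close> of the coordinate change, so its
  derivative along \<open>X\<close> differs from a tangent vector by the derivative of \<open>J\<close>. This defect is a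
  second derivative of the coordinate change, evaluated on \<open>X\<close> and \<open>Y\<close>.
\<close>
lemma local_rep_derivative_transition:
  assumes X: "X \<in> vector_fields" and Y: "Y \<in> vector_fields"
    and c: "c \<in> \<A>" "p \<in> fst c" and d: "d \<in> \<A>" "p \<in> fst d"
  shows "frechet_derivative (local_rep d Y) (at (snd d p)) (X p d) =
    jacobian c d (snd c p) (frechet_derivative (local_rep c Y) (at (snd c p)) (X p c)) +
    frechet_derivative (\<lambda>z. jacobian c d z (Y p c)) (at (snd c p)) (X p c)"
proof -
  let ?z = "snd c p"
  have zS: "?z \<in> overlap c d" using c d by auto
  have z: "transition c d ?z = snd d p" using c d by simp
  have "((\<lambda>z. local_rep d Y (transition c d z)) has_derivative
      (\<lambda>v. frechet_derivative (local_rep d Y) (at (snd d p)) (jacobian c d ?z v))) (at ?z)"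
    by (rule has_derivative_compose[OF transition_has_derivative[OF c(1) d(1) c(2) d(2)]])
      (use vector_fields_has_derivative[OF Y d] in \<open>simp only: z\<close>)
  then have 1: "((\<lambda>z. jacobian c d z (local_rep c Y z)) has_derivative
      (\<lambda>v. frechet_derivative (local_rep d Y) (at (snd d p)) (jacobian c d ?z v))) (at ?z)"
  proof (rule has_derivative_transform_within_open[OF _ open_overlap[OF c(1) d(1)] zS])
    fix z assume "z \<in> overlap c d"
    then obtain q where q: "z = snd c q" "q \<in> fst c" "q \<in> fst d" by blast
    show "local_rep d Y (transition c d z) = jacobian c d z (local_rep c Y z)"
      using tangent_space_transition[OF vector_fields_tangent[OF Y c(1) q(2)] c(1) d(1) q(2,3)] q c d by simp
  qed
  have "((\<lambda>z. jacobian c d z (local_rep c Y z)) has_derivative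
      (\<lambda>v. jacobian c d ?z (frechet_derivative (local_rep c Y) (at ?z) v) +
        frechet_derivative (\<lambda>z. jacobian c d z (local_rep c Y ?z)) (at ?z) v)) (at ?z)"
  proof (rule has_derivative_linear_family[OF open_overlap[OF c(1) d(1)] zS])
    show "linear (jacobian c d z)" if "z \<in> overlap c d" for z
      using that linear_jacobian[OF c(1) d(1)] by blast
    show "((\<lambda>z. jacobian c d z e) has_derivative frechet_derivative (\<lambda>z. jacobian c d z e) (at ?z)) (at ?z)" for e
      by (rule smooth_on_has_derivative[OF smooth_on_derivative[OF smooth_transition[OF c(1) d(1)]] zS])
    show "(local_rep c Y has_derivative frechet_derivative (local_rep c Y) (at ?z)) (at ?z)"
      by (rule vector_fields_has_derivative[OF Y c])
  qed
  from has_derivative_unique[OF 1 this]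
  have "frechet_derivative (local_rep d Y) (at (snd d p)) (jacobian c d ?z (X p c)) =
      jacobian c d ?z (frechet_derivative (local_rep c Y) (at ?z) (X p c)) +
        frechet_derivative (\<lambda>z. jacobian c d z (local_rep c Y ?z)) (at ?z) (X p c)"
    by metis
  then show ?thesis
    using tangent_space_transition[OF vector_fields_tangent[OF X c] c(1) d(1) c(2) d(2)] c by simp
qed

text \<open>
  The two defects of the previous lemma are exchanged by swapping \<open>X\<close> and \<open>Y\<close>, hence they cancel in the
  bracket by symmetry of second derivatives.
\<close>
lemma lie_bracket_tangent:
  assumes X: "X \<in> vector_fields" and Y: "Y \<in> vector_fields"
  shows "lie_bracket \<A> X Y p \<in> tangent_space \<A> p"
proof (rule tangent_spaceI)
  show "lie_bracket \<A> X Y p c = 0" if "\<not> (c \<in> \<A> \<and> p \<in> fst c)" for c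
    using that by (auto simp: lie_bracket_def)
  fix c d assume cd: "c \<in> \<A>" "d \<in> \<A>" "p \<in> fst c" "p \<in> fst d"
  then have c: "c \<in> \<A>" "p \<in> fst c" and d: "d \<in> \<A>" "p \<in> fst d" by simp_all
  let ?z = "snd c p"
  have "Ck_on 2 (overlap c d) (transition c d)"
    using smooth_transition[OF c(1) d(1)] by (simp add: smooth_on_def)
  then have sym: "frechet_derivative (\<lambda>z. jacobian c d z (Y p c)) (at ?z) (X p c) =
      frechet_derivative (\<lambda>z. jacobian c d z (X p c)) (at ?z) (Y p c)"
    using c d by (intro symmetric_second_derivative[OF open_overlap[OF c(1) d(1)]]) auto
  show "lie_bracket \<A> X Y p d = jacobian c d ?z (lie_bracket \<A> X Y p c)"
    unfolding lie_bracket_local_rep[OF X Y c] lie_bracket_local_rep[OF X Y d]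
      local_rep_derivative_transition[OF X Y c d] local_rep_derivative_transition[OF Y X c d]
      sym linear_diff[OF linear_jacobian[OF c(1) d(1) c(2) d(2)]] by simp
qed

lemma lie_bracket_vector_field:
  assumes X: "X \<in> vector_fields" and Y: "Y \<in> vector_fields"
  shows "lie_bracket \<A> X Y \<in> vector_fields"
  unfolding vector_fields_def
proof (intro CollectI conjI ballI)
  fix c assume c: "c \<in> \<A>"
  have D: "smooth_on (chart_image c) (\<lambda>z. frechet_derivative (local_rep c Y) (at z) (local_rep c X z))"
    if "X \<in> vector_fields" "Y \<in> vector_fields" for X Y
  proof (rule smooth_on_linear_family[OF open_chart_image[OF c],
        where G = "\<lambda>z. frechet_derivative (local_rep c Y) (at z)" and h = "local_rep c X"])
    note Y = vector_fields_smooth[OF that(2) c]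
    show "linear (frechet_derivative (local_rep c Y) (at z))" if "z \<in> chart_image c" for z
      by (rule has_derivative_linear[OF smooth_on_has_derivative[OF Y that]])
    show "smooth_on (chart_image c) (\<lambda>z. frechet_derivative (local_rep c Y) (at z) e)" for e
      by (rule smooth_on_derivative[OF Y])
    show "smooth_on (chart_image c) (local_rep c X)"
      by (rule vector_fields_smooth[OF that(1) c])
  qed
  show "smooth_on (chart_image c) (local_rep c (lie_bracket \<A> X Y))"
    by (rule smooth_on_cong[OF open_chart_image[OF c] _ smooth_on_diff[OF open_chart_image[OF c] D[OF X Y] D[OF Y X]]])
      (simp add: lie_bracket_local_rep[OF X Y c] chart_inv_mem chart_chart_inv c)
qed (use lie_bracket_tangent[OF X Y] in auto)

lemma vector_fields_cong:
  assumes "X \<in> vector_fields" "\<And>p. p \<in> carrier \<A> \<Longrightarrow> X p = X' p"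
  shows "X' \<in> vector_fields"
proof -
  have "smooth_on (chart_image c) (local_rep c X')" if "c \<in> \<A>" for c
    by (rule smooth_on_cong[OF open_chart_image[OF that] _ vector_fields_smooth[OF assms(1) that]])
      (simp add: assms(2)[OF carrierI[OF that]] chart_inv_mem that)
  then show ?thesis using assms by (auto simp: vector_fields_def)
qed

text \<open>
  Fields on a manifold are represented by total functions on the type of points, whose values off the
  manifold are arbitrary; the bracket at a point only sees the values on the domain of a chart.
\<close>
lemma lie_bracket_cong:
  assumes X: "X \<in> vector_fields" and Y: "Y \<in> vector_fields"
    and eq: "\<And>p. p \<in> carrier \<A> \<Longrightarrow> X p = X' p" "\<And>p. p \<in> carrier \<A> \<Longrightarrow> Y p = Y' p"
    and p: "p \<in> carrier \<A>"
  shows "lie_bracket \<A> X Y p = lie_bracket \<A> X' Y' p"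
proof -
  obtain c where c: "c \<in> \<A>" "p \<in> fst c" using p carrierE by blast
  have X': "X' \<in> vector_fields" and Y': "Y' \<in> vector_fields"
    using vector_fields_cong[OF X eq(1)] vector_fields_cong[OF Y eq(2)] by blast+
  have D: "frechet_derivative (local_rep c X) (at (snd c p)) = frechet_derivative (local_rep c X') (at (snd c p))"
    if "\<And>p. p \<in> carrier \<A> \<Longrightarrow> X p = X' p" for X X'
    by (rule frechet_derivative_cong_open[OF open_chart_image[OF c(1)] chart_mem_image[OF c(2)]])
      (simp add: that carrierI[OF c(1)] chart_inv_mem c)
  show ?thesis
    by (rule tangent_eqI[OF lie_bracket_tangent[OF X Y] lie_bracket_tangent[OF X' Y'] c])
      (simp add: lie_bracket_local_rep[OF X Y c] lie_bracket_local_rep[OF X' Y' c] D[of X X'] D[of Y Y'] eq p)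
qed

end

lemma smooth_manifold_imp_smooth_atlas:
  assumes "smooth_manifold M \<A>"
  shows "smooth_atlas \<A>"
proof
  fix c assume c: "c \<in> \<A>"
  have hom: "homeomorphic_map (subtopology M (fst c)) (top_of_set (chart_image c)) (snd c)"
    and opn: "open (chart_image c)" and sub: "openin M (fst c)"
    using assms c unfolding smooth_manifold_def by blast+
  have tc: "topspace (subtopology M (fst c)) = fst c"
    using openin_subset[OF sub] by auto
  show "inj_on (snd c) (fst c)"
    using homeomorphic_imp_injective_map[OF hom] tc by simp
  fix d assume d: "d \<in> \<A>"
  show "smooth_on (snd c ` (fst c \<inter> fst d)) (snd d \<circ> chart_inv c)"
    using assms c d unfolding smooth_manifold_def by blast
  have "openin M (fst d)" using assms d unfolding smooth_manifold_def by blast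
  then have "openin (subtopology M (fst c)) (fst c \<inter> fst d)"
    by (auto simp: openin_subtopology Int_commute)
  then have "openin (top_of_set (chart_image c)) (snd c ` (fst c \<inter> fst d))"
    using homeomorphic_imp_open_map[OF hom] by (simp add: open_map_def)
  then show "open (snd c ` (fst c \<inter> fst d))"
    using openin_open_trans opn by blast
qed

section \<open>The slit bundle as a manifold\<close>

context smooth_atlas
begin

lemma slit_chart_domain: "u \<in> fst (slit_chart \<A> c) \<longleftrightarrow> u \<in> slit_bundle \<A> \<and> fst u \<in> fst c"
  by (simp add: slit_chart_def)

lemma slit_chart_apply: "snd (slit_chart \<A> c) u = (snd c (fst u), snd u c)"
  by (simp add: slit_chart_def split_beta)

lemma slit_bundle_iff:
  "u \<in> slit_bundle \<A> \<longleftrightarrow> fst u \<in> carrier \<A> \<and> snd u \<in> tangent_space \<A> (fst u) \<and> snd u \<noteq> 0"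
  by (auto simp: slit_bundle_def)

lemma coord_vec_in_slit_chart:
  assumes "c \<in> \<A>" "p \<in> fst c" "y \<noteq> 0"
  shows "(p, coord_vec \<A> c y p) \<in> fst (slit_chart \<A> c)"
proof -
  have "coord_vec \<A> c y p c \<noteq> 0" using assms by (simp add: coord_vec_component)
  then have "coord_vec \<A> c y p \<noteq> 0" by (metis zero_fun_apply)
  then show ?thesis
    using assms carrierI[OF assms(1,2)] by (simp add: slit_chart_domain slit_bundle_iff coord_vec_tangent)
qed

lemma slit_component_nonzero:
  assumes "c \<in> \<A>" "u \<in> fst (slit_chart \<A> c)"
  shows "snd u c \<noteq> 0"
  using tangent_eqI[OF _ tangent_space_zero assms(1), of "snd u" "fst u"] assms(2)
  by (auto simp: slit_chart_domain slit_bundle_iff)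

lemma slit_chart_overlap:
  assumes "c \<in> \<A>"
  shows "snd (slit_chart \<A> c) ` (fst (slit_chart \<A> c) \<inter> fst (slit_chart \<A> d)) = overlap c d \<times> (- {0})"
proof (intro subset_antisym subsetI)
  fix z assume "z \<in> snd (slit_chart \<A> c) ` (fst (slit_chart \<A> c) \<inter> fst (slit_chart \<A> d))"
  then show "z \<in> overlap c d \<times> (- {0})"
    using slit_component_nonzero[OF assms] by (auto simp: slit_chart_apply slit_chart_domain)
next
  fix z assume "z \<in> overlap c d \<times> (- {0::'e})"
  then have "fst z \<in> overlap c d" "snd z \<noteq> 0" by (simp_all add: mem_Times_iff)
  then obtain p where p: "p \<in> fst c" "p \<in> fst d" "fst z = snd c p" "snd z \<noteq> 0" by blast
  have "(p, coord_vec \<A> c (snd z) p) \<in> fst (slit_chart \<A> c)"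
    by (rule coord_vec_in_slit_chart[OF assms p(1,4)])
  moreover from this have "(p, coord_vec \<A> c (snd z) p) \<in> fst (slit_chart \<A> d)"
    using p by (simp add: slit_chart_domain)
  moreover have "snd (slit_chart \<A> c) (p, coord_vec \<A> c (snd z) p) = z"
    using p assms by (simp add: slit_chart_apply coord_vec_component prod_eq_iff)
  ultimately show "z \<in> snd (slit_chart \<A> c) ` (fst (slit_chart \<A> c) \<inter> fst (slit_chart \<A> d))"
    by (metis (no_types, lifting) IntI image_eqI)
qed

lemma inj_slit_chart:
  assumes "c \<in> \<A>"
  shows "inj_on (snd (slit_chart \<A> c)) (fst (slit_chart \<A> c))"
proof (rule inj_onI)
  fix u w assume *: "u \<in> fst (slit_chart \<A> c)" "w \<in> fst (slit_chart \<A> c)"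
    "snd (slit_chart \<A> c) u = snd (slit_chart \<A> c) w"
  then have fst_eq: "fst u = fst w"
    using inj_onD[OF inj_chart[OF assms]] by (auto simp: slit_chart_apply slit_chart_domain)
  moreover have "snd u = snd w"
    by (rule tangent_eqI[of _ "fst u" _ c]) (use * assms fst_eq in \<open>auto simp: slit_chart_apply slit_chart_domain slit_bundle_iff\<close>)
  ultimately show "u = w" by (rule prod_eqI)
qed

lemma slit_chart_inv:
  assumes "c \<in> \<A>" "x \<in> chart_image c" "y \<noteq> 0"
  shows "chart_inv (slit_chart \<A> c) (x, y) = (chart_inv c x, coord_vec \<A> c y (chart_inv c x))"
proof -
  let ?u = "(chart_inv c x, coord_vec \<A> c y (chart_inv c x))"
  have "snd (slit_chart \<A> c) ?u = (x, y)"
    using assms by (simp add: slit_chart_apply chart_chart_inv coord_vec_component chart_inv_mem)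
  moreover have "?u \<in> fst (slit_chart \<A> c)"
    using assms by (intro coord_vec_in_slit_chart) (simp_all add: chart_inv_mem)
  ultimately show ?thesis
    unfolding chart_inv_def[of "slit_chart \<A> c"] using inv_into_f_f[OF inj_slit_chart[OF assms(1)]] by metis
qed

text \<open>
  A tangent vector is determined by its component in one chart, and its other components are obtained
  by the Jacobian. Hence the coordinate change of the slit bundle is the tangent map of the
  coordinate change of the base.
\<close>
lemma slit_transition:
  assumes "c \<in> \<A>" "d \<in> \<A>" "z \<in> overlap c d \<times> (- {0})"
  shows "(snd (slit_chart \<A> d) \<circ> chart_inv (slit_chart \<A> c)) z =
    (transition c d (fst z), jacobian c d (fst z) (snd z))"
proof -
  have *: "fst z \<in> chart_image c" "snd z \<noteq> 0" using assms(3) by (auto simp: chart_image_def)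
  have "chart_inv c (fst z) \<in> fst d" using assms by auto
  then show ?thesis
    using slit_chart_inv[OF assms(1) *] assms *
    by (simp add: slit_chart_apply coord_vec_def chart_chart_inv)
qed

lemma smooth_slit_transition:
  assumes "c \<in> \<A>" "d \<in> \<A>"
  shows "smooth_on (overlap c d \<times> (- {0})) (snd (slit_chart \<A> d) \<circ> chart_inv (slit_chart \<A> c))"
proof -
  let ?S = "overlap c d \<times> (- {0::'e})"
  have S: "open ?S" using open_overlap[OF assms] by (intro open_Times) auto
  note o = open_overlap[OF assms] and tr = smooth_transition[OF assms]
  have "smooth_on ?S (\<lambda>z. jacobian c d (fst z) (snd z))"
  proof (rule smooth_on_linear_family[OF S, where G = "\<lambda>z. jacobian c d (fst z)" and h = snd])
    show "linear (jacobian c d (fst z))" if "z \<in> ?S" for z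
      using that linear_jacobian[OF assms] by auto
    show "smooth_on ?S (\<lambda>z. jacobian c d (fst z) e)" for e
      by (rule smooth_on_compose_linear[OF o S bounded_linear_fst _ smooth_on_derivative[OF tr]]) auto
    show "smooth_on ?S snd" by (rule smooth_on_bounded_linear[OF S bounded_linear_snd])
  qed
  moreover have "smooth_on ?S (\<lambda>z. transition c d (fst z))"
    by (rule smooth_on_compose_linear[OF o S bounded_linear_fst _ tr]) auto
  ultimately have "smooth_on ?S (\<lambda>z. (transition c d (fst z), jacobian c d (fst z) (snd z)))"
    by (intro smooth_on_Pair S)
  then show ?thesis
    by (rule smooth_on_cong[OF S, rotated]) (simp only: slit_transition[OF assms])
qed

lemma smooth_slit_atlas: "smooth_atlas (slit_atlas \<A>)"
proof
  fix s t assume "s \<in> slit_atlas \<A>" "t \<in> slit_atlas \<A>"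
  then obtain c d where c: "c \<in> \<A>" "s = slit_chart \<A> c" and d: "d \<in> \<A>" "t = slit_chart \<A> d"
    unfolding slit_atlas_def by blast
  show "inj_on (snd s) (fst s)" using inj_slit_chart c by simp
  show "open (snd s ` (fst s \<inter> fst t))"
    unfolding c(2) d(2) slit_chart_overlap[OF c(1)]
    using open_overlap[OF c(1) d(1)] by (intro open_Times) auto
  show "smooth_on (snd s ` (fst s \<inter> fst t)) (snd t \<circ> chart_inv s)"
    unfolding c(2) d(2) slit_chart_overlap[OF c(1)] by (rule smooth_slit_transition[OF c(1) d(1)])
qed

end

text \<open>
  A separate name for the base atlas: only its instances get the slit atlas as a second instance of
  \<^locale>\<open>smooth_atlas\<close>, as declaring this for \<^locale>\<open>smooth_atlas\<close> itself would iterate the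
  construction forever.
\<close>
locale slit_geometry = smooth_atlas \<A> for \<A> :: "('a, 'e::euclidean_space) chart set"

sublocale slit_geometry \<subseteq> slit: smooth_atlas "slit_atlas \<A>"
  by (rule smooth_slit_atlas)

context slit_geometry
begin

lemma slit_chart_in_atlas: "c \<in> \<A> \<Longrightarrow> slit_chart \<A> c \<in> slit_atlas \<A>"
  by (simp add: slit_atlas_def)

lemma slit_atlasE:
  assumes "s \<in> slit_atlas \<A>" obtains c where "c \<in> \<A>" "s = slit_chart \<A> c"
  using assms unfolding slit_atlas_def by blast

lemma carrier_slit_atlas: "carrier (slit_atlas \<A>) = slit_bundle \<A>"
proof (intro subset_antisym subsetI)
  fix u assume "u \<in> carrier (slit_atlas \<A>)"
  then obtain s where "s \<in> slit_atlas \<A>" "u \<in> fst s" by (rule slit.carrierE)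
  then show "u \<in> slit_bundle \<A>" by (metis slit_atlasE slit_chart_domain)
next
  fix u assume u: "u \<in> slit_bundle \<A>"
  then obtain c where "c \<in> \<A>" "fst u \<in> fst c" using carrierE by (metis slit_bundle_iff)
  then show "u \<in> carrier (slit_atlas \<A>)"
    using u slit.carrierI[OF slit_chart_in_atlas] by (simp add: slit_chart_domain)
qed

lemma slit_bundleE:
  assumes "u \<in> slit_bundle \<A>"
  obtains c where "c \<in> \<A>" "fst u \<in> fst c" "u \<in> fst (slit_chart \<A> c)"
  using assms carrierE by (metis slit_bundle_iff slit_chart_domain)

lemma
  assumes "c \<in> \<A>" "z \<in> chart_image (slit_chart \<A> c)"
  shows slit_chart_inv_mem: "chart_inv (slit_chart \<A> c) z \<in> fst (slit_chart \<A> c)"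
    and slit_chart_inv_bundle: "chart_inv (slit_chart \<A> c) z \<in> slit_bundle \<A>"
    and slit_chart_inv_base: "fst (chart_inv (slit_chart \<A> c) z) \<in> fst c"
  using slit.chart_inv_mem[OF slit_chart_in_atlas[OF assms(1)] assms(2)] slit_chart_domain by blast+

text \<open>
  The tangent map sends \<open>(x, y)\<close> to \<open>(\<phi> x, D\<phi> x y)\<close>. Its Jacobian has block triangular form with \<open>D\<phi> x\<close> in
  both diagonal blocks, which makes horizontal components and vertical vectors independent
  of the chart.
\<close>
lemma slit_jacobian:
  assumes c: "c \<in> \<A>" "fst u \<in> fst c" and d: "d \<in> \<A>" "fst u \<in> fst d" and u: "u \<in> slit_bundle \<A>"
  shows "fst (slit.jacobian (slit_chart \<A> c) (slit_chart \<A> d) (snd (slit_chart \<A> c) u) w) =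
      jacobian c d (snd c (fst u)) (fst w)"
    and "snd (slit.jacobian (slit_chart \<A> c) (slit_chart \<A> d) (snd (slit_chart \<A> c) u) (0, y)) =
      jacobian c d (snd c (fst u)) y"
proof -
  let ?S = "overlap c d \<times> (- {0::'e})"
  let ?z = "snd (slit_chart \<A> c) u"
  let ?H = "\<lambda>e. frechet_derivative (\<lambda>x. jacobian c d x e) (at (fst ?z))"
  have S: "open ?S" using open_overlap[OF c(1) d(1)] by (intro open_Times) auto
  have z: "?z \<in> ?S" unfolding slit_chart_overlap[OF c(1), symmetric]
    using c d u by (auto simp: slit_chart_domain)
  have zo: "fst ?z \<in> overlap c d" using z by (auto simp: mem_Times_iff)
  have H: "((\<lambda>x. jacobian c d x e) has_derivative ?H e) (at (fst ?z))" for e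
    by (rule smooth_on_has_derivative[OF smooth_on_derivative[OF smooth_transition[OF c(1) d(1)]] zo])
  have "((\<lambda>z. jacobian c d (fst z) (snd z)) has_derivative
      (\<lambda>v. jacobian c d (fst ?z) (snd v) + ?H (snd ?z) (fst v))) (at ?z)"
  proof (rule has_derivative_linear_family[OF S z, where G' = "\<lambda>v e. ?H e (fst v)" and G = "\<lambda>z. jacobian c d (fst z)"])
    show "linear (jacobian c d (fst z))" if "z \<in> ?S" for z
      using that linear_jacobian[OF c(1) d(1)] by auto
    show "((\<lambda>z. jacobian c d (fst z) e) has_derivative (\<lambda>v. ?H e (fst v))) (at ?z)" for e
      by (rule has_derivative_compose[OF bounded_linear_imp_has_derivative[OF bounded_linear_fst] H])
    show "(snd has_derivative snd) (at ?z)"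
      by (rule bounded_linear_imp_has_derivative[OF bounded_linear_snd])
  qed
  moreover have "((\<lambda>z. transition c d (fst z)) has_derivative (\<lambda>v. jacobian c d (fst ?z) (fst v))) (at ?z)"
    by (rule has_derivative_compose[OF bounded_linear_imp_has_derivative[OF bounded_linear_fst]])
      (rule smooth_on_has_derivative[OF smooth_transition[OF c(1) d(1)] zo])
  ultimately have "((\<lambda>z. (transition c d (fst z), jacobian c d (fst z) (snd z))) has_derivative
      (\<lambda>v. (jacobian c d (fst ?z) (fst v), jacobian c d (fst ?z) (snd v) + ?H (snd ?z) (fst v)))) (at ?z)"
    by (intro has_derivative_Pair)
  then have "(slit.transition (slit_chart \<A> c) (slit_chart \<A> d) has_derivative
      (\<lambda>v. (jacobian c d (fst ?z) (fst v), jacobian c d (fst ?z) (snd v) + ?H (snd ?z) (fst v)))) (at ?z)"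
    by (rule has_derivative_transform_within_open[OF _ S z]) (simp only: slit_transition[OF c(1) d(1)])
  from frechet_derivative_at[OF this]
  have J: "slit.jacobian (slit_chart \<A> c) (slit_chart \<A> d) ?z =
      (\<lambda>v. (jacobian c d (fst ?z) (fst v), jacobian c d (fst ?z) (snd v) + ?H (snd ?z) (fst v)))" by simp
  have "?H (snd ?z) 0 = 0" by (rule linear_0[OF has_derivative_linear[OF H]])
  then show "fst (slit.jacobian (slit_chart \<A> c) (slit_chart \<A> d) ?z w) = jacobian c d (snd c (fst u)) (fst w)"
    "snd (slit.jacobian (slit_chart \<A> c) (slit_chart \<A> d) ?z (0, y)) = jacobian c d (snd c (fst u)) y"
    unfolding J by (simp_all add: slit_chart_apply)
qed

section \<open>Projection, vertical lift and sections\<close>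

lemma rho_component:
  assumes c: "c \<in> \<A>" "fst u \<in> fst c" and u: "u \<in> slit_bundle \<A>"
    and X: "X \<in> tangent_space (slit_atlas \<A>) u"
  shows "rho \<A> u X c = fst (X (slit_chart \<A> c))"
proof -
  let ?s = "slit_chart \<A> c"
  have s: "?s \<in> slit_atlas \<A>" "u \<in> fst ?s" using c u by (simp_all add: slit_chart_in_atlas slit_chart_domain)
  have "((snd c \<circ> fst) \<circ> chart_inv ?s has_derivative fst) (at (snd ?s u))"
  proof (rule has_derivative_transform_within_open[OF bounded_linear_imp_has_derivative[OF bounded_linear_fst]
        slit.open_chart_image[OF s(1)] slit.chart_mem_image[OF s(2)]])
    fix z assume z: "z \<in> chart_image ?s"
    have "snd ?s (chart_inv ?s z) = z" by (rule slit.chart_chart_inv[OF s(1) z])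
    then show "fst z = ((snd c \<circ> fst) \<circ> chart_inv ?s) z"
      unfolding slit_chart_apply o_def by (metis fst_conv)
  qed
  from slit.deriv_along_chart[OF s X this] show ?thesis
    using c by (simp add: rho_def differential_def)
qed

lemma rho_tangent:
  assumes u: "u \<in> slit_bundle \<A>" and X: "X \<in> tangent_space (slit_atlas \<A>) u"
  shows "rho \<A> u X \<in> tangent_space \<A> (fst u)"
proof (rule tangent_spaceI)
  show "rho \<A> u X c = 0" if "\<not> (c \<in> \<A> \<and> fst u \<in> fst c)" for c
    using that by (auto simp: rho_def differential_def)
  fix c d assume cd: "c \<in> \<A>" "d \<in> \<A>" "fst u \<in> fst c" "fst u \<in> fst d"
  have "X (slit_chart \<A> d) = slit.jacobian (slit_chart \<A> c) (slit_chart \<A> d) (snd (slit_chart \<A> c) u) (X (slit_chart \<A> c))"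
    using cd u by (intro slit.tangent_space_transition[OF X] slit_chart_in_atlas) (simp_all add: slit_chart_domain)
  then show "rho \<A> u X d = jacobian c d (snd c (fst u)) (rho \<A> u X c)"
    using slit_jacobian(1)[OF cd(1,3,2,4) u] rho_component[OF cd(1,3) u X] rho_component[OF cd(2,4) u X] by simp
qed

lemma rho_eqI:
  assumes "u \<in> slit_bundle \<A>" "X \<in> tangent_space (slit_atlas \<A>) u" "v \<in> tangent_space \<A> (fst u)"
    and "c \<in> \<A>" "fst u \<in> fst c" "fst (X (slit_chart \<A> c)) = v c"
  shows "rho \<A> u X = v"
  by (rule tangent_eqI[OF rho_tangent[OF assms(1,2)] assms(3,4,5)]) (simp add: rho_component assms)

lemma rho_lincomb:
  assumes u: "u \<in> slit_bundle \<A>"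
    and X: "X \<in> tangent_space (slit_atlas \<A>) u" "Y \<in> tangent_space (slit_atlas \<A>) u"
  shows "rho \<A> u (a \<odot> X + b \<odot> Y) = a \<odot> rho \<A> u X + b \<odot> rho \<A> u Y"
proof -
  obtain c where c: "c \<in> \<A>" "fst u \<in> fst c" using u by (rule slit_bundleE)
  show ?thesis
    by (rule rho_eqI[OF u slit.tangent_space_lincomb[OF X] tangent_space_lincomb[OF rho_tangent[OF u X(1)] rho_tangent[OF u X(2)]] c])
      (simp add: rho_component[OF c u] X)
qed

lemma vert_lift_component:
  assumes c: "c \<in> \<A>" "fst u \<in> fst c" and u: "u \<in> slit_bundle \<A>"
  shows "vert_lift \<A> u v (slit_chart \<A> c) = (0, v c)"
proof -
  have *: "(fst u, snd u + 0 \<odot> v) = u" by (simp add: prod_eq_iff plus_fun_def)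
  have "((\<lambda>t. (snd c (fst u), snd u c + t *\<^sub>R v c)) has_vector_derivative (0, v c)) (at 0)"
    unfolding has_vector_derivative_def
    by (auto intro!: derivative_eq_intros)
  moreover have "snd (slit_chart \<A> c) \<circ> (\<lambda>t. (fst u, snd u + t \<odot> v)) = (\<lambda>t. (snd c (fst u), snd u c + t *\<^sub>R v c))"
    by (rule ext) (simp add: slit_chart_apply)
  ultimately have "vector_derivative (snd (slit_chart \<A> c) \<circ> (\<lambda>t. (fst u, snd u + t \<odot> v))) (at 0) = (0, v c)"
    using vector_derivative_at by metis
  then show ?thesis
    using c u * by (simp add: vert_lift_def velocity_def slit_chart_in_atlas slit_chart_domain)
qed

lemma vert_lift_tangent:
  assumes u: "u \<in> slit_bundle \<A>" and v: "v \<in> tangent_space \<A> (fst u)"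
  shows "vert_lift \<A> u v \<in> tangent_space (slit_atlas \<A>) u"
proof (rule slit.tangent_spaceI)
  have *: "(fst u, snd u + 0 \<odot> v) = u" by (simp add: prod_eq_iff plus_fun_def)
  show "vert_lift \<A> u v s = 0" if "\<not> (s \<in> slit_atlas \<A> \<and> u \<in> fst s)" for s
    using that * by (auto simp: vert_lift_def velocity_def)
  fix s t assume st: "s \<in> slit_atlas \<A>" "t \<in> slit_atlas \<A>" "u \<in> fst s" "u \<in> fst t"
  obtain c d where c: "c \<in> \<A>" "s = slit_chart \<A> c" and d: "d \<in> \<A>" "t = slit_chart \<A> d"
    using st slit_atlasE by metis
  have cd: "fst u \<in> fst c" "fst u \<in> fst d" using st c d by (simp_all add: slit_chart_domain)
  show "vert_lift \<A> u v t = slit.jacobian s t (snd s u) (vert_lift \<A> u v s)"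
    unfolding c(2) d(2) vert_lift_component[OF c(1) cd(1) u] vert_lift_component[OF d(1) cd(2) u]
    using slit_jacobian[OF c(1) cd(1) d(1) cd(2) u] tangent_space_transition[OF v c(1) d(1) cd]
      linear_0[OF linear_jacobian[OF c(1) d(1) cd]]
    by (simp add: prod_eq_iff)
qed

lemma rho_vert_lift:
  assumes u: "u \<in> slit_bundle \<A>" and v: "v \<in> tangent_space \<A> (fst u)"
  shows "rho \<A> u (vert_lift \<A> u v) = 0"
proof -
  obtain c where c: "c \<in> \<A>" "fst u \<in> fst c" using u by (rule slit_bundleE)
  show ?thesis
    by (rule rho_eqI[OF u vert_lift_tangent[OF u v] tangent_space_zero c]) (simp add: vert_lift_component c u)
qed

lemma pi_fields_tangent: "Y \<in> pi_fields \<A> \<Longrightarrow> u \<in> slit_bundle \<A> \<Longrightarrow> Y u \<in> tangent_space \<A> (fst u)"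
  unfolding pi_fields_def by blast

lemma pi_fields_smooth:
  "Y \<in> pi_fields \<A> \<Longrightarrow> c \<in> \<A> \<Longrightarrow> smooth_on (chart_image (slit_chart \<A> c)) (\<lambda>z. Y (chart_inv (slit_chart \<A> c) z) c)"
  unfolding pi_fields_def by blast

lemma pi_fieldsI:
  assumes "\<And>u. u \<in> slit_bundle \<A> \<Longrightarrow> Y u \<in> tangent_space \<A> (fst u)"
    and "\<And>c. c \<in> \<A> \<Longrightarrow> smooth_on (chart_image (slit_chart \<A> c)) (\<lambda>z. Y (chart_inv (slit_chart \<A> c) z) c)"
  shows "Y \<in> pi_fields \<A>"
  using assms unfolding pi_fields_def by blast

lemma open_slit_chart_image: "c \<in> \<A> \<Longrightarrow> open (chart_image (slit_chart \<A> c))"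
  by (rule slit.open_chart_image[OF slit_chart_in_atlas])

lemma pi_fields_cong:
  assumes "Y \<in> pi_fields \<A>" "\<And>u. u \<in> slit_bundle \<A> \<Longrightarrow> Y u = Z u"
  shows "Z \<in> pi_fields \<A>"
proof (rule pi_fieldsI)
  show "Z u \<in> tangent_space \<A> (fst u)" if "u \<in> slit_bundle \<A>" for u
    using pi_fields_tangent[OF assms(1) that] assms(2)[OF that] by simp
  show "smooth_on (chart_image (slit_chart \<A> c)) (\<lambda>z. Z (chart_inv (slit_chart \<A> c) z) c)" if "c \<in> \<A>" for c
    by (rule smooth_on_cong[OF open_slit_chart_image[OF that] _ pi_fields_smooth[OF assms(1) that]])
      (simp add: assms(2) slit_chart_inv_bundle that)
qed

lemma pi_fields_diff:
  assumes "Y \<in> pi_fields \<A>" "Z \<in> pi_fields \<A>"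
  shows "(\<lambda>u. Y u - Z u) \<in> pi_fields \<A>"
  using assms by (intro pi_fieldsI) (simp_all add: tangent_space_diff pi_fields_tangent smooth_on_diff pi_fields_smooth open_slit_chart_image)

lemma pi_fields_zero: "(\<lambda>u. 0) \<in> pi_fields \<A>"
  by (intro pi_fieldsI) (simp_all add: tangent_space_zero smooth_on_const open_slit_chart_image)

lemma eta_pi_field: "eta \<in> pi_fields \<A>"
proof (rule pi_fieldsI)
  fix c assume c: "c \<in> \<A>"
  show "smooth_on (chart_image (slit_chart \<A> c)) (\<lambda>z. eta (chart_inv (slit_chart \<A> c) z) c)"
  proof (rule smooth_on_cong[OF open_slit_chart_image[OF c] _ smooth_on_bounded_linear[OF open_slit_chart_image[OF c] bounded_linear_snd]])
    fix z assume "z \<in> chart_image (slit_chart \<A> c)"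
    then show "snd z = eta (chart_inv (slit_chart \<A> c) z) c"
      using slit.chart_chart_inv[OF slit_chart_in_atlas[OF c]] unfolding eta_def slit_chart_apply by (metis snd_conv)
  qed
qed (simp add: eta_def slit_bundle_iff)

lemma slit_vector_fieldI:
  assumes "\<And>u. u \<in> slit_bundle \<A> \<Longrightarrow> X u \<in> tangent_space (slit_atlas \<A>) u"
    and "\<And>c. c \<in> \<A> \<Longrightarrow> smooth_on (chart_image (slit_chart \<A> c))
      (\<lambda>z. X (chart_inv (slit_chart \<A> c) z) (slit_chart \<A> c))"
  shows "X \<in> slit.vector_fields"
  using assms slit_atlasE unfolding slit.vector_fields_def carrier_slit_atlas by blast

lemma slit_vector_fields_tangent:
  "X \<in> slit.vector_fields \<Longrightarrow> u \<in> slit_bundle \<A> \<Longrightarrow> X u \<in> tangent_space (slit_atlas \<A>) u"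
  unfolding slit.vector_fields_def carrier_slit_atlas by blast

lemma vert_field_vector_field:
  assumes Y: "Y \<in> pi_fields \<A>"
  shows "vert_field \<A> Y \<in> slit.vector_fields"
proof (rule slit_vector_fieldI)
  show "vert_field \<A> Y u \<in> tangent_space (slit_atlas \<A>) u" if "u \<in> slit_bundle \<A>" for u
    unfolding vert_field_def by (rule vert_lift_tangent[OF that pi_fields_tangent[OF Y that]])
  fix c assume c: "c \<in> \<A>"
  show "smooth_on (chart_image (slit_chart \<A> c)) (\<lambda>z. vert_field \<A> Y (chart_inv (slit_chart \<A> c) z) (slit_chart \<A> c))"
  proof (rule smooth_on_cong[OF open_slit_chart_image[OF c] _ smooth_on_Pair[OF open_slit_chart_image[OF c]
        smooth_on_const[OF open_slit_chart_image[OF c]] pi_fields_smooth[OF Y c]]])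
    fix z assume z: "z \<in> chart_image (slit_chart \<A> c)"
    show "(0, Y (chart_inv (slit_chart \<A> c) z) c) = vert_field \<A> Y (chart_inv (slit_chart \<A> c) z) (slit_chart \<A> c)"
      by (simp add: vert_field_def vert_lift_component c slit_chart_inv_base[OF c z] slit_chart_inv_bundle[OF c z])
  qed
qed

lemma rho_pi_field:
  assumes X: "X \<in> slit.vector_fields"
  shows "(\<lambda>u. rho \<A> u (X u)) \<in> pi_fields \<A>"
proof (rule pi_fieldsI)
  show "rho \<A> u (X u) \<in> tangent_space \<A> (fst u)" if "u \<in> slit_bundle \<A>" for u
    by (rule rho_tangent[OF that slit_vector_fields_tangent[OF X that]])
  fix c assume c: "c \<in> \<A>"
  show "smooth_on (chart_image (slit_chart \<A> c))
      (\<lambda>z. rho \<A> (chart_inv (slit_chart \<A> c) z) (X (chart_inv (slit_chart \<A> c) z)) c)"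
  proof (rule smooth_on_cong[OF open_slit_chart_image[OF c] _ smooth_on_bounded_linear_comp[OF open_slit_chart_image[OF c]
        bounded_linear_fst slit.vector_fields_smooth[OF X slit_chart_in_atlas[OF c]]]])
    fix z assume z: "z \<in> chart_image (slit_chart \<A> c)"
    note b = slit_chart_inv_bundle[OF c z]
    show "fst (X (chart_inv (slit_chart \<A> c) z) (slit_chart \<A> c)) =
        rho \<A> (chart_inv (slit_chart \<A> c) z) (X (chart_inv (slit_chart \<A> c) z)) c"
      by (rule rho_component[OF c slit_chart_inv_base[OF c z] b slit_vector_fields_tangent[OF X b], symmetric])
  qed
qed

end

section \<open>Connections on the pulled-back bundle\<close>

locale pi_connection = slit_geometry \<A> for \<A> :: "('a, 'e::euclidean_space) chart set" +
  fixes D :: "('a, 'e) conn"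
  assumes conn: "connection \<A> D"
begin

lemma
  assumes u: "u \<in> slit_bundle \<A>" and X: "X \<in> tangent_space (slit_atlas \<A>) u" and Y: "Y \<in> pi_fields \<A>"
  shows conn_tangent: "D u X Y \<in> tangent_space \<A> (fst u)"
    and conn_cong: "Z \<in> pi_fields \<A> \<Longrightarrow> (\<And>w. w \<in> slit_bundle \<A> \<Longrightarrow> Y w = Z w) \<Longrightarrow> D u X Y = D u X Z"
    and conn_lincomb: "W \<in> tangent_space (slit_atlas \<A>) u \<Longrightarrow> D u (a \<odot> X + b \<odot> W) Y = a \<odot> D u X Y + b \<odot> D u W Y"
    and conn_add: "Z \<in> pi_fields \<A> \<Longrightarrow> D u X (\<lambda>w. Y w + Z w) = D u X Y + D u X Z"
proof -
  note * = conn[unfolded connection_def, THEN conjunct1, rule_format, OF u X Y]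
  show "D u X Y \<in> tangent_space \<A> (fst u)" using * by blast
  show "D u X Y = D u X Z" if "Z \<in> pi_fields \<A>" "\<And>w. w \<in> slit_bundle \<A> \<Longrightarrow> Y w = Z w"
    using * that by blast
  show "D u (a \<odot> X + b \<odot> W) Y = a \<odot> D u X Y + b \<odot> D u W Y" if "W \<in> tangent_space (slit_atlas \<A>) u"
    using * that by blast
  show "D u X (\<lambda>w. Y w + Z w) = D u X Y + D u X Z" if "Z \<in> pi_fields \<A>"
    using * that by blast
qed

lemma conn_frame_smooth:
  assumes "Y \<in> pi_fields \<A>" "c \<in> \<A>"
  shows "smooth_on (chart_image (slit_chart \<A> c)) (\<lambda>z. D (chart_inv (slit_chart \<A> c) z)
    (coord_vec (slit_atlas \<A>) (slit_chart \<A> c) e (chart_inv (slit_chart \<A> c) z)) Y c)"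
  using conn[unfolded connection_def Let_def, THEN conjunct2] assms by blast

lemma conn_frame_linear:
  assumes u: "u \<in> slit_bundle \<A>" and c: "c \<in> \<A>" "fst u \<in> fst c" and Y: "Y \<in> pi_fields \<A>"
  shows "linear (\<lambda>e. D u (coord_vec (slit_atlas \<A>) (slit_chart \<A> c) e u) Y c)"
proof (rule linearI)
  have s: "slit_chart \<A> c \<in> slit_atlas \<A>" "u \<in> fst (slit_chart \<A> c)"
    using u c by (simp_all add: slit_chart_in_atlas slit_chart_domain)
  note t = slit.coord_vec_tangent[OF s]
  show "D u (coord_vec (slit_atlas \<A>) (slit_chart \<A> c) (e + f) u) Y c =
      D u (coord_vec (slit_atlas \<A>) (slit_chart \<A> c) e u) Y c + D u (coord_vec (slit_atlas \<A>) (slit_chart \<A> c) f u) Y c" for e f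
    unfolding slit.coord_vec_add[OF s] conn_lincomb[OF u t Y t] by simp
  show "D u (coord_vec (slit_atlas \<A>) (slit_chart \<A> c) (r *\<^sub>R e) u) Y c =
      r *\<^sub>R D u (coord_vec (slit_atlas \<A>) (slit_chart \<A> c) e u) Y c" for r e
    unfolding slit.coord_vec_scale[OF s] conn_lincomb[OF u t Y t] by simp
qed

lemma conn_zero_field:
  assumes "u \<in> slit_bundle \<A>" "X \<in> tangent_space (slit_atlas \<A>) u"
  shows "D u X (\<lambda>w. 0) = 0"
  using conn_add[OF assms pi_fields_zero pi_fields_zero] by simp

lemma conn_diff:
  assumes "u \<in> slit_bundle \<A>" "X \<in> tangent_space (slit_atlas \<A>) u" "Y \<in> pi_fields \<A>" "Z \<in> pi_fields \<A>"
  shows "D u X (\<lambda>w. Y w - Z w) = D u X Y - D u X Z"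
  using conn_add[OF assms(1,2) pi_fields_diff[OF assms(3,4)] assms(4)] by simp

text \<open>
  The smoothness of a connection is required on coordinate frames only. By linearity in the direction,
  the derivative along \<open>X\<close> is a linear family, smooth on every fixed frame vector, evaluated
  at the components of \<open>X\<close>.
\<close>
lemma nabla_pi_field:
  assumes X: "X \<in> slit.vector_fields" and Y: "Y \<in> pi_fields \<A>"
  shows "nabla D X Y \<in> pi_fields \<A>"
proof (rule pi_fieldsI)
  show "nabla D X Y u \<in> tangent_space \<A> (fst u)" if "u \<in> slit_bundle \<A>" for u
    unfolding nabla_def by (rule conn_tangent[OF that slit_vector_fields_tangent[OF X that] Y])
  fix c assume c: "c \<in> \<A>"
  let ?s = "slit_chart \<A> c"
  note s = slit_chart_in_atlas[OF c]
  have "smooth_on (chart_image ?s) (\<lambda>z. D (chart_inv ?s z)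
      (coord_vec (slit_atlas \<A>) ?s (X (chart_inv ?s z) ?s) (chart_inv ?s z)) Y c)"
  proof (rule smooth_on_linear_family[OF open_slit_chart_image[OF c],
        where G = "\<lambda>z e. D (chart_inv ?s z) (coord_vec (slit_atlas \<A>) ?s e (chart_inv ?s z)) Y c"])
    show "linear (\<lambda>e. D (chart_inv ?s z) (coord_vec (slit_atlas \<A>) ?s e (chart_inv ?s z)) Y c)"
      if "z \<in> chart_image ?s" for z
      by (rule conn_frame_linear[OF slit_chart_inv_bundle[OF c that] c slit_chart_inv_base[OF c that] Y])
  qed (rule conn_frame_smooth[OF Y c] slit.vector_fields_smooth[OF X s])+
  then show "smooth_on (chart_image ?s) (\<lambda>z. nabla D X Y (chart_inv ?s z) c)"
  proof (rule smooth_on_cong[OF open_slit_chart_image[OF c], rotated])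
    fix z assume z: "z \<in> chart_image ?s"
    show "D (chart_inv ?s z) (coord_vec (slit_atlas \<A>) ?s (X (chart_inv ?s z) ?s) (chart_inv ?s z)) Y c =
        nabla D X Y (chart_inv ?s z) c"
      unfolding nabla_def
      by (subst slit.coord_vec_of_component[OF slit_vector_fields_tangent[OF X slit_chart_inv_bundle[OF c z]]
            s slit_chart_inv_mem[OF c z]]) (rule refl)
  qed
qed

lemma torsion_form_pi_field:
  assumes X: "X \<in> slit.vector_fields" and Y: "Y \<in> slit.vector_fields"
  shows "torsion_form \<A> D X Y \<in> pi_fields \<A>"
proof -
  have "(\<lambda>u. nabla D X (\<lambda>w. rho \<A> w (Y w)) u - nabla D Y (\<lambda>w. rho \<A> w (X w)) u -
      rho \<A> u (lie_bracket (slit_atlas \<A>) X Y u)) \<in> pi_fields \<A>"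
    by (intro pi_fields_diff nabla_pi_field rho_pi_field slit.lie_bracket_vector_field X Y)
  then show ?thesis by (simp add: torsion_form_def[abs_def])
qed

end

section \<open>Horizontal lifts of a regular connection\<close>

locale regular_pi_connection = pi_connection +
  assumes reg: "regular \<A> D"
begin

lemma
  assumes u: "u \<in> slit_bundle \<A>" and v: "v \<in> tangent_space \<A> (fst u)"
  shows beta_horizontal: "beta \<A> D u v \<in> horizontal \<A> D u"
    and rho_beta: "rho \<A> u (beta \<A> D u v) = v"
proof -
  obtain c where c: "c \<in> \<A>" "fst u \<in> fst c" "u \<in> fst (slit_chart \<A> c)" using u by (rule slit_bundleE)
  let ?X = "coord_vec (slit_atlas \<A>) (slit_chart \<A> c) (v c, 0) u"
  have X: "?X \<in> tangent_space (slit_atlas \<A>) u"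
    by (rule slit.coord_vec_tangent[OF slit_chart_in_atlas[OF c(1)] c(3)])
  have rX: "rho \<A> u ?X = v"
    by (rule rho_eqI[OF u X v c(1,2)]) (simp add: slit.coord_vec_component[OF slit_chart_in_atlas[OF c(1)] c(3)])
  obtain V H where VH: "?X = V + H" "V \<in> vertical \<A> u" "H \<in> horizontal \<A> D u"
    using X unfolding reg[unfolded regular_def, rule_format, OF u, THEN conjunct1] by blast
  have "rho \<A> u (1 \<odot> V + 1 \<odot> H) = 1 \<odot> rho \<A> u V + 1 \<odot> rho \<A> u H"
    using VH by (intro rho_lincomb[OF u]) (simp_all add: vertical_def horizontal_def)
  then have "rho \<A> u H = v"
    using VH rX by (simp add: vertical_def flip: zero_fun_def)
  then have "v \<in> rho \<A> u ` horizontal \<A> D u" using VH(3) by blast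
  then show "beta \<A> D u v \<in> horizontal \<A> D u" "rho \<A> u (beta \<A> D u v) = v"
    unfolding beta_def by (rule inv_into_into, rule f_inv_into_f)
qed

lemma vertical_horizontal_zero:
  assumes "u \<in> slit_bundle \<A>" "X \<in> tangent_space (slit_atlas \<A>) u" "rho \<A> u X = 0" "D u X eta = 0"
  shows "X = 0"
proof -
  have "X \<in> vertical \<A> u \<inter> horizontal \<A> D u"
    using assms(2-4) by (simp add: vertical_def horizontal_def conn_map_def)
  then show ?thesis
    unfolding reg[unfolded regular_def, rule_format, OF assms(1), THEN conjunct2] by simp
qed

lemma beta_rho:
  assumes u: "u \<in> slit_bundle \<A>" and X: "X \<in> horizontal \<A> D u"
  shows "beta \<A> D u (rho \<A> u X) = X"
proof -
  have Xt: "X \<in> tangent_space (slit_atlas \<A>) u" and X0: "D u X eta = 0"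
    using X by (simp_all add: horizontal_def conn_map_def)
  let ?B = "beta \<A> D u (rho \<A> u X)"
  have Bh: "?B \<in> horizontal \<A> D u" and rB: "rho \<A> u ?B = rho \<A> u X"
    using beta_horizontal rho_beta u rho_tangent[OF u Xt] by blast+
  then have Bt: "?B \<in> tangent_space (slit_atlas \<A>) u" and B0: "D u ?B eta = 0"
    by (simp_all add: horizontal_def conn_map_def)
  have "1 \<odot> ?B + (-1) \<odot> X = 0"
  proof (rule vertical_horizontal_zero[OF u slit.tangent_space_lincomb[OF Bt Xt]])
    show "rho \<A> u (1 \<odot> ?B + (-1) \<odot> X) = 0"
      unfolding rho_lincomb[OF u Bt Xt] rB by (simp add: plus_fun_def zero_fun_def)
    show "D u (1 \<odot> ?B + (-1) \<odot> X) eta = 0"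
      unfolding conn_lincomb[OF u Bt eta_pi_field Xt] B0 X0 by (simp add: plus_fun_def zero_fun_def)
  qed
  then show ?thesis by (simp add: fun_eq_iff)
qed

lemma
  assumes X: "X \<in> pi_fields \<A>" and u: "u \<in> slit_bundle \<A>"
  shows hor_field_tangent: "hor_field \<A> D X u \<in> tangent_space (slit_atlas \<A>) u"
    and hor_field_eta: "D u (hor_field \<A> D X u) eta = 0"
    and rho_hor_field: "rho \<A> u (hor_field \<A> D X u) = X u"
  using beta_horizontal[OF u pi_fields_tangent[OF X u]] rho_beta[OF u pi_fields_tangent[OF X u]]
  by (simp_all add: hor_field_def horizontal_def conn_map_def)

text \<open>
  In a chart the horizontal lift of \<open>X\<close> is \<open>(X, b)\<close>, where the condition that the connection map
  vanishes is a linear system for \<open>b\<close>. Its matrix is the connection map on vertical vectors,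
  which is injective as \<open>V \<inter> H = 0\<close>; so \<open>b\<close> depends smoothly on the point.
\<close>
lemma hor_field_vector_field:
  assumes X: "X \<in> pi_fields \<A>"
  shows "hor_field \<A> D X \<in> slit.vector_fields"
proof (rule slit_vector_fieldI)
  show "hor_field \<A> D X u \<in> tangent_space (slit_atlas \<A>) u" if "u \<in> slit_bundle \<A>" for u
    by (rule hor_field_tangent[OF X that])
  fix c assume c: "c \<in> \<A>"
  let ?s = "slit_chart \<A> c"
  let ?u = "chart_inv ?s"
  note s = slit_chart_in_atlas[OF c] and o = open_slit_chart_image[OF c]
  define K where "K = (\<lambda>z e. D (?u z) (coord_vec (slit_atlas \<A>) ?s e (?u z)) eta c)"
  have K_linear: "linear (K z)" if "z \<in> chart_image ?s" for z
    unfolding K_def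
    by (rule conn_frame_linear[OF slit_chart_inv_bundle[OF c that] c slit_chart_inv_base[OF c that] eta_pi_field])
  have K_smooth: "smooth_on (chart_image ?s) (\<lambda>z. K z e)" for e
    unfolding K_def by (rule conn_frame_smooth[OF eta_pi_field c])
  have Kv_linear: "linear (\<lambda>e. K z (0, e))" and Kh_linear: "linear (\<lambda>e. K z (e, 0))"
    if "z \<in> chart_image ?s" for z
    using linear_compose[OF bounded_linear.linear[OF bounded_linear_Pair[OF bounded_linear_zero bounded_linear_ident]] K_linear[OF that]]
      linear_compose[OF bounded_linear.linear[OF bounded_linear_Pair[OF bounded_linear_ident bounded_linear_zero]] K_linear[OF that]]
    by (simp_all add: o_def)
  have Kv_inj: "inj (\<lambda>e. K z (0, e))" if z: "z \<in> chart_image ?s" for z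
    unfolding linear_injective_0[OF Kv_linear[OF z]]
  proof (intro allI impI)
    fix e assume e: "K z (0, e) = 0"
    let ?V = "coord_vec (slit_atlas \<A>) ?s (0, e) (?u z)"
    note b = slit_chart_inv_bundle[OF c z] and m = slit_chart_inv_mem[OF c z]
    have V: "?V \<in> tangent_space (slit_atlas \<A>) (?u z)" by (rule slit.coord_vec_tangent[OF s m])
    have comp: "?V ?s = (0, e)" by (rule slit.coord_vec_component[OF s m])
    have "rho \<A> (?u z) ?V = 0"
      by (rule rho_eqI[OF b V tangent_space_zero c slit_chart_inv_base[OF c z]]) (simp add: comp)
    moreover have "D (?u z) ?V eta = 0"
      by (rule tangent_eqI[OF conn_tangent[OF b V eta_pi_field] tangent_space_zero c slit_chart_inv_base[OF c z]])
        (use e in \<open>simp add: K_def\<close>)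
    ultimately have "?V = 0" by (rule vertical_horizontal_zero[OF b V])
    then show "e = 0" using comp by (simp add: prod_eq_iff)
  qed
  have comp: "fst (hor_field \<A> D X (?u z) ?s) = X (?u z) c" if z: "z \<in> chart_image ?s" for z
    using rho_component[OF c slit_chart_inv_base[OF c z] slit_chart_inv_bundle[OF c z]
        hor_field_tangent[OF X slit_chart_inv_bundle[OF c z]]]
      rho_hor_field[OF X slit_chart_inv_bundle[OF c z]] by simp
  have "smooth_on (chart_image ?s) (\<lambda>z. snd (hor_field \<A> D X (?u z) ?s))"
  proof (rule smooth_on_solution[where P = "\<lambda>z e. K z (0, e)" and q = "\<lambda>z. - K z (X (?u z) c, 0)", OF o])
    have "smooth_on (chart_image ?s) (\<lambda>z. K z (X (?u z) c, 0))"
      by (rule smooth_on_linear_family[where G = "\<lambda>z e. K z (e, 0)", OF o])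
        (rule Kh_linear K_smooth pi_fields_smooth[OF X c], assumption?)+
    then show "smooth_on (chart_image ?s) (\<lambda>z. - K z (X (?u z) c, 0))"
      by (rule smooth_on_minus[OF o])
    fix z assume z: "z \<in> chart_image ?s"
    note b = slit_chart_inv_bundle[OF c z]
    have "0 = D (?u z) (hor_field \<A> D X (?u z)) eta c" by (simp add: hor_field_eta[OF X b])
    also have "\<dots> = K z (hor_field \<A> D X (?u z) ?s)"
      unfolding K_def slit.coord_vec_of_component[OF hor_field_tangent[OF X b] s slit_chart_inv_mem[OF c z]] ..
    also have "hor_field \<A> D X (?u z) ?s = (X (?u z) c, 0) + (0, snd (hor_field \<A> D X (?u z) ?s))"
      by (simp add: prod_eq_iff comp[OF z])
    finally show "K z (0, snd (hor_field \<A> D X (?u z) ?s)) = - K z (X (?u z) c, 0)"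
      unfolding linear_add[OF K_linear[OF z]] by (simp add: eq_neg_iff_add_eq_0 add.commute)
  qed (rule Kv_linear Kv_inj K_smooth, assumption?)+
  from smooth_on_Pair[OF o pi_fields_smooth[OF X c] this]
  show "smooth_on (chart_image ?s) (\<lambda>z. hor_field \<A> D X (?u z) ?s)"
    by (rule smooth_on_cong[OF o, rotated]) (simp add: prod_eq_iff comp)
qed

lemma nabla_hor_pi_field:
  "X \<in> pi_fields \<A> \<Longrightarrow> Y \<in> pi_fields \<A> \<Longrightarrow> nabla D (hor_field \<A> D X) Y \<in> pi_fields \<A>"
  by (intro nabla_pi_field hor_field_vector_field)

lemma conn_rho_hor_field:
  assumes u: "u \<in> slit_bundle \<A>" and X: "X \<in> tangent_space (slit_atlas \<A>) u" and Y: "Y \<in> pi_fields \<A>"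
  shows "D u X (\<lambda>w. rho \<A> w (hor_field \<A> D Y w)) = D u X Y"
  by (rule conn_cong[OF u X rho_pi_field[OF hor_field_vector_field[OF Y]] Y]) (simp add: rho_hor_field[OF Y])

text \<open>
  As \<open>\<rho> \<circ> \<gamma> = 0\<close> and \<open>\<rho> \<circ> \<beta> = id\<close>, the connection enters the mixed torsion through a single
  vertical derivative; apart from that the torsion depends on the horizontal lift only.
\<close>
lemma T_tensor_eq:
  assumes X: "X \<in> pi_fields \<A>" and Y: "Y \<in> pi_fields \<A>" and u: "u \<in> slit_bundle \<A>"
  shows "T_tensor \<A> D X Y u = D u (vert_field \<A> X u) Y -
    rho \<A> u (lie_bracket (slit_atlas \<A>) (vert_field \<A> X) (hor_field \<A> D Y) u)"
proof -
  note Vt = slit_vector_fields_tangent[OF vert_field_vector_field[OF X] u]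
  note Ht = hor_field_tangent[OF Y u]
  have "D u (hor_field \<A> D Y u) (\<lambda>w. rho \<A> w (vert_field \<A> X w)) = D u (hor_field \<A> D Y u) (\<lambda>w. 0)"
    by (rule conn_cong[OF u Ht rho_pi_field[OF vert_field_vector_field[OF X]] pi_fields_zero])
      (simp add: vert_field_def rho_vert_lift pi_fields_tangent[OF X])
  also have "\<dots> = 0" by (rule conn_zero_field[OF u Ht])
  finally show ?thesis
    by (simp add: T_tensor_def torsion_form_def nabla_def conn_rho_hor_field[OF u Vt Y] fun_eq_iff)
qed

lemma T_tensor_pi_field:
  "X \<in> pi_fields \<A> \<Longrightarrow> Y \<in> pi_fields \<A> \<Longrightarrow> T_tensor \<A> D X Y \<in> pi_fields \<A>"
  unfolding T_tensor_def by (intro torsion_form_pi_field vert_field_vector_field hor_field_vector_field)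

text \<open>
  Tensor fields act on total functions, so that it has to be checked that values off the slit bundle do not matter.
\<close>
lemma T_tensor_cong:
  assumes X: "X \<in> pi_fields \<A>" and Y: "Y \<in> pi_fields \<A>" and u: "u \<in> slit_bundle \<A>"
    and eq: "\<And>w. w \<in> slit_bundle \<A> \<Longrightarrow> X w = X' w" "\<And>w. w \<in> slit_bundle \<A> \<Longrightarrow> Y w = Y' w"
  shows "T_tensor \<A> D X Y u = T_tensor \<A> D X' Y' u"
proof -
  have X': "X' \<in> pi_fields \<A>" and Y': "Y' \<in> pi_fields \<A>"
    using pi_fields_cong[OF X eq(1)] pi_fields_cong[OF Y eq(2)] by blast+
  have "lie_bracket (slit_atlas \<A>) (vert_field \<A> X) (hor_field \<A> D Y) u =
      lie_bracket (slit_atlas \<A>) (vert_field \<A> X') (hor_field \<A> D Y') u"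
    by (rule slit.lie_bracket_cong[OF vert_field_vector_field[OF X] hor_field_vector_field[OF Y]])
      (simp_all add: carrier_slit_atlas u eq vert_field_def hor_field_def)
  moreover have "vert_field \<A> X u = vert_field \<A> X' u" by (simp add: vert_field_def eq u)
  moreover have "D u (vert_field \<A> X u) Y = D u (vert_field \<A> X u) Y'"
    by (rule conn_cong[OF u slit_vector_fields_tangent[OF vert_field_vector_field[OF X] u] Y Y' eq(2)])
  ultimately show ?thesis unfolding T_tensor_eq[OF X Y u] T_tensor_eq[OF X' Y' u] by simp
qed

lemma rho_bracket_hor_field:
  assumes X: "X \<in> pi_fields \<A>" and Y: "Y \<in> pi_fields \<A>" and u: "u \<in> slit_bundle \<A>"
    and S: "S_tensor \<A> D X Y u = 0"
  shows "rho \<A> u (lie_bracket (slit_atlas \<A>) (hor_field \<A> D X) (hor_field \<A> D Y) u) =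
    nabla D (hor_field \<A> D X) Y u - nabla D (hor_field \<A> D Y) X u"
  using S by (simp add: S_tensor_def torsion_form_def nabla_def
      conn_rho_hor_field[OF u hor_field_tangent[OF X u] Y] conn_rho_hor_field[OF u hor_field_tangent[OF Y u] X])

text \<open>
  Horizontal derivatives of the fundamental section vanish by definition of the horizontal space, so
  that in \<open>R(X, Y)\<eta>\<close> only the bracket term remains: it is the connection map of \<open>[\<beta>X, \<beta>Y]\<close>.
\<close>
lemma R_tensor_eta:
  assumes X: "X \<in> pi_fields \<A>" and Y: "Y \<in> pi_fields \<A>" and u: "u \<in> slit_bundle \<A>"
  shows "R_tensor \<A> D X Y eta u = D u (lie_bracket (slit_atlas \<A>) (hor_field \<A> D X) (hor_field \<A> D Y) u) eta"
proof -
  have "nabla D (hor_field \<A> D Z) (nabla D (hor_field \<A> D W) eta) u = 0"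
    if Z: "Z \<in> pi_fields \<A>" and W: "W \<in> pi_fields \<A>" for Z W
  proof -
    have "D u (hor_field \<A> D Z u) (nabla D (hor_field \<A> D W) eta) = D u (hor_field \<A> D Z u) (\<lambda>w. 0)"
      by (rule conn_cong[OF u hor_field_tangent[OF Z u] nabla_hor_pi_field[OF W eta_pi_field] pi_fields_zero])
        (simp add: nabla_def hor_field_eta[OF W] zero_fun_def)
    also have "\<dots> = 0" by (rule conn_zero_field[OF u hor_field_tangent[OF Z u]])
    finally show ?thesis unfolding nabla_def .
  qed
  from this[OF X Y] this[OF Y X] show ?thesis
    by (simp add: R_tensor_def curvature_form_def nabla_def)
qed

text \<open>
  Vanishing of \<open>R(X, Y)\<eta>\<close> makes the bracket \<open>[\<beta>X, \<beta>Y]\<close> horizontal, and vanishing of \<open>S\<close> identifies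
  its projection. It is important that the bracket is exhibited as the lift of a globally defined
  smooth section: this makes facts about horizontal lifts of sections applicable to it.
\<close>
lemma flat_bracket_hor_field:
  assumes X: "X \<in> pi_fields \<A>" and Y: "Y \<in> pi_fields \<A>" and u: "u \<in> slit_bundle \<A>"
    and S: "S_tensor \<A> D X Y u = 0" and R: "R_tensor \<A> D X Y eta u = 0"
  shows "lie_bracket (slit_atlas \<A>) (hor_field \<A> D X) (hor_field \<A> D Y) u =
    hor_field \<A> D (\<lambda>w. nabla D (hor_field \<A> D X) Y w - nabla D (hor_field \<A> D Y) X w) u"
proof -
  let ?B = "lie_bracket (slit_atlas \<A>) (hor_field \<A> D X) (hor_field \<A> D Y) u"
  have "?B \<in> horizontal \<A> D u"
    using R slit.lie_bracket_tangent[OF hor_field_vector_field[OF X] hor_field_vector_field[OF Y], of u]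
    by (simp add: R_tensor_eta[OF X Y u] horizontal_def conn_map_def)
  from beta_rho[OF u this] show ?thesis
    by (simp add: hor_field_def rho_bracket_hor_field[OF X Y u S])
qed

end

section \<open>Two connections with the same horizontal derivatives\<close>

text \<open>
  A formulation of \<open>B = 0\<close> that is symmetric in the two connections, so that every
  consequence may also be used with the connections exchanged.
\<close>
locale equal_horizontal_transport =
  regular_pi_connection \<A> D + second: regular_pi_connection \<A> D'
  for \<A> :: "('a, 'e::euclidean_space) chart set" and D D' :: "('a, 'e) conn" +
  assumes hor_field_eq: "X \<in> pi_fields \<A> \<Longrightarrow> u \<in> slit_bundle \<A> \<Longrightarrow> hor_field \<A> D X u = hor_field \<A> D' X u"
    and conn_hor_eq: "X \<in> pi_fields \<A> \<Longrightarrow> Y \<in> pi_fields \<A> \<Longrightarrow> u \<in> slit_bundle \<A> \<Longrightarrow>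
      D u (hor_field \<A> D X u) Y = D' u (hor_field \<A> D' X u) Y"
begin

lemma nabla_hor_eq:
  "X \<in> pi_fields \<A> \<Longrightarrow> Y \<in> pi_fields \<A> \<Longrightarrow> u \<in> slit_bundle \<A> \<Longrightarrow>
    nabla D (hor_field \<A> D X) Y u = nabla D' (hor_field \<A> D' X) Y u"
  unfolding nabla_def by (rule conn_hor_eq)

text \<open>
  The bracket terms of the two torsions agree because the horizontal lifts do.
\<close>
lemma A_tensor_eq_T_tensor_diff:
  assumes X: "X \<in> pi_fields \<A>" and Y: "Y \<in> pi_fields \<A>" and u: "u \<in> slit_bundle \<A>"
  shows "A_tensor \<A> D D' X Y u = T_tensor \<A> D' X Y u - T_tensor \<A> D X Y u"
proof -
  have "lie_bracket (slit_atlas \<A>) (vert_field \<A> X) (hor_field \<A> D Y) u =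
      lie_bracket (slit_atlas \<A>) (vert_field \<A> X) (hor_field \<A> D' Y) u"
    by (rule slit.lie_bracket_cong[OF vert_field_vector_field[OF X] hor_field_vector_field[OF Y]])
      (simp_all add: carrier_slit_atlas u hor_field_eq Y)
  then show ?thesis
    by (simp add: A_tensor_def nabla_def T_tensor_eq[OF X Y u] second.T_tensor_eq[OF X Y u])
qed

text \<open>
  In each of the three terms of the covariant derivative of \<open>A = T\<^sup>* - T\<close> the horizontal derivative
  with respect to the first connection may be replaced by the one with respect to the second.
\<close>
lemma nabla_A_tensor:
  assumes X: "X \<in> pi_fields \<A>" and Y: "Y \<in> pi_fields \<A>" and Z: "Z \<in> pi_fields \<A>" and u: "u \<in> slit_bundle \<A>"
  shows "nabla_tensor D (hor_field \<A> D X) (A_tensor \<A> D D') Y Z u =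
    nabla_tensor D' (hor_field \<A> D' X) (T_tensor \<A> D') Y Z u -
    nabla_tensor D (hor_field \<A> D X) (T_tensor \<A> D) Y Z u"
proof -
  note T = T_tensor_pi_field[OF Y Z] and T' = second.T_tensor_pi_field[OF Y Z]
  note Ht = hor_field_tangent[OF X u]
  note NY = nabla_hor_pi_field[OF X Y] and NZ = nabla_hor_pi_field[OF X Z]
  have "D u (hor_field \<A> D X u) (A_tensor \<A> D D' Y Z) =
      D u (hor_field \<A> D X u) (\<lambda>w. T_tensor \<A> D' Y Z w - T_tensor \<A> D Y Z w)"
    by (rule conn_cong[OF u Ht pi_fields_cong[OF pi_fields_diff[OF T' T]] pi_fields_diff[OF T' T]])
      (simp_all add: A_tensor_eq_T_tensor_diff[OF Y Z])
  also have "\<dots> = D u (hor_field \<A> D X u) (T_tensor \<A> D' Y Z) - D u (hor_field \<A> D X u) (T_tensor \<A> D Y Z)"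
    by (rule conn_diff[OF u Ht T' T])
  also have "D u (hor_field \<A> D X u) (T_tensor \<A> D' Y Z) = D' u (hor_field \<A> D' X u) (T_tensor \<A> D' Y Z)"
    by (rule conn_hor_eq[OF X T' u])
  finally have 1: "nabla D (hor_field \<A> D X) (A_tensor \<A> D D' Y Z) u =
      nabla D' (hor_field \<A> D' X) (T_tensor \<A> D' Y Z) u - nabla D (hor_field \<A> D X) (T_tensor \<A> D Y Z) u"
    unfolding nabla_def .
  have 2: "A_tensor \<A> D D' (nabla D (hor_field \<A> D X) Y) Z u =
      T_tensor \<A> D' (nabla D' (hor_field \<A> D' X) Y) Z u - T_tensor \<A> D (nabla D (hor_field \<A> D X) Y) Z u"
    unfolding A_tensor_eq_T_tensor_diff[OF NY Z u]
    using second.T_tensor_cong[OF NY Z u nabla_hor_eq[OF X Y] refl] by simp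
  have 3: "A_tensor \<A> D D' Y (nabla D (hor_field \<A> D X) Z) u =
      T_tensor \<A> D' Y (nabla D' (hor_field \<A> D' X) Z) u - T_tensor \<A> D Y (nabla D (hor_field \<A> D X) Z) u"
    unfolding A_tensor_eq_T_tensor_diff[OF Y NZ u]
    using second.T_tensor_cong[OF Y NZ u refl nabla_hor_eq[OF X Z]] by simp
  show ?thesis unfolding nabla_tensor_def 1 2 3 by simp
qed

text \<open>
  The second-order terms of the curvatures always agree. The bracket terms could differ
  by a vertical contribution \<open>A(K[\<beta>X, \<beta>Y], Z)\<close>, and flatness of the first connection excludes it.
\<close>
lemma R_tensor_eq_of_flat:
  assumes X: "X \<in> pi_fields \<A>" and Y: "Y \<in> pi_fields \<A>" and Z: "Z \<in> pi_fields \<A>" and u: "u \<in> slit_bundle \<A>"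
    and S: "S_tensor \<A> D X Y u = 0" and R: "R_tensor \<A> D X Y eta u = 0"
  shows "R_tensor \<A> D' X Y Z u = R_tensor \<A> D X Y Z u"
proof -
  have second_order: "nabla D (hor_field \<A> D W) (nabla D (hor_field \<A> D V) Z) u =
      nabla D' (hor_field \<A> D' W) (nabla D' (hor_field \<A> D' V) Z) u"
    if V: "V \<in> pi_fields \<A>" and W: "W \<in> pi_fields \<A>" for V W
  proof -
    have "D' u (hor_field \<A> D' W u) (nabla D (hor_field \<A> D V) Z) =
        D' u (hor_field \<A> D' W u) (nabla D' (hor_field \<A> D' V) Z)"
      by (rule second.conn_cong[OF u second.hor_field_tangent[OF W u] nabla_hor_pi_field[OF V Z]
            second.nabla_hor_pi_field[OF V Z] nabla_hor_eq[OF V Z]])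
    then show ?thesis
      using conn_hor_eq[OF W nabla_hor_pi_field[OF V Z] u] by (simp add: nabla_def)
  qed
  let ?W = "\<lambda>w. nabla D (hor_field \<A> D X) Y w - nabla D (hor_field \<A> D Y) X w"
  \<comment> \<open>The bracket of the horizontal lifts is the lift of this section.\<close>
  have W: "?W \<in> pi_fields \<A>"
    by (intro pi_fields_diff nabla_hor_pi_field X Y)
  have "lie_bracket (slit_atlas \<A>) (hor_field \<A> D' X) (hor_field \<A> D' Y) u =
      lie_bracket (slit_atlas \<A>) (hor_field \<A> D X) (hor_field \<A> D Y) u"
    by (rule slit.lie_bracket_cong[OF second.hor_field_vector_field[OF X] second.hor_field_vector_field[OF Y]])
      (simp_all add: carrier_slit_atlas u hor_field_eq X Y)
  also have "\<dots> = hor_field \<A> D ?W u"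
    by (rule flat_bracket_hor_field[OF X Y u S R])
  finally have bracket: "lie_bracket (slit_atlas \<A>) (hor_field \<A> D' X) (hor_field \<A> D' Y) u = hor_field \<A> D' ?W u"
    by (simp add: hor_field_eq[OF W u])
  show ?thesis
    unfolding R_tensor_def curvature_form_def second_order[OF X Y] second_order[OF Y X]
    using conn_hor_eq[OF W Z u] bracket flat_bracket_hor_field[OF X Y u S R]
    by (simp add: nabla_def)
qed

end

text \<open>
  For \<open>Y = \<eta>\<close> the equation \<open>B(X, Y) = 0\<close> says that the second connection map also vanishes on \<open>\<beta>X\<close>. So \<open>\<beta>X\<close> is
  horizontal for both connections and equals \<open>\<beta>\<^sup>*X\<close>.
\<close>
lemma equal_horizontal_transportI:
  assumes "regular_pi_connection \<A> D" "regular_pi_connection \<A> D'"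
    and B: "\<forall>X\<in>pi_fields \<A>. \<forall>Y\<in>pi_fields \<A>. \<forall>u\<in>slit_bundle \<A>. B_tensor \<A> D D' X Y u = 0"
  shows "equal_horizontal_transport \<A> D D'"
proof -
  interpret regular_pi_connection \<A> D by fact
  interpret second: regular_pi_connection \<A> D' by fact
  have D: "D u (hor_field \<A> D X u) Y = D' u (hor_field \<A> D X u) Y"
    if "X \<in> pi_fields \<A>" "Y \<in> pi_fields \<A>" "u \<in> slit_bundle \<A>" for X Y u
    using B that by (simp add: B_tensor_def nabla_def)
  have hor: "hor_field \<A> D X u = hor_field \<A> D' X u"
    if X: "X \<in> pi_fields \<A>" and u: "u \<in> slit_bundle \<A>" for X u
  proof -
    have "hor_field \<A> D X u \<in> horizontal \<A> D' u"
      using hor_field_tangent[OF X u] hor_field_eta[OF X u] D[OF X eta_pi_field u]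
      by (simp add: horizontal_def conn_map_def)
    from second.beta_rho[OF u this] show ?thesis
      by (simp add: rho_hor_field[OF X u]) (simp add: hor_field_def)
  qed
  show ?thesis
    by unfold_locales (use D hor in auto)
qed

section \<open>Locally Minkowskian Finsler manifolds\<close>

theorem theorem5p2:
  fixes M :: "'a topology"
    and \<A> :: "('a, 'e::euclidean_space) chart set"
    and L L' :: "('a, 'e) lagr"
    and D D' :: "('a, 'e) conn"
  assumes "smooth_manifold M \<A>"
    and "finsler_structure \<A> L"
    and "finsler_structure \<A> L'"
    and "cartan_connection \<A> L D"
    and "cartan_connection \<A> L' D'"
    and "\<forall>X\<in>pi_fields \<A>. \<forall>Y\<in>pi_fields \<A>. \<forall>u\<in>slit_bundle \<A>. B_tensor \<A> D D' X Y u = 0"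
  shows "(locally_minkowskian \<A> L D \<longrightarrow>
            (locally_minkowskian \<A> L' D' \<longleftrightarrow>
              (\<forall>X\<in>pi_fields \<A>. \<forall>Y\<in>pi_fields \<A>. \<forall>Z\<in>pi_fields \<A>. \<forall>u\<in>slit_bundle \<A>.
                 nabla_tensor D (hor_field \<A> D X) (A_tensor \<A> D D') Y Z u = 0)))
       \<and> (locally_minkowskian \<A> L' D' \<longrightarrow>
            (locally_minkowskian \<A> L D \<longleftrightarrow>
              (\<forall>X\<in>pi_fields \<A>. \<forall>Y\<in>pi_fields \<A>. \<forall>Z\<in>pi_fields \<A>. \<forall>u\<in>slit_bundle \<A>.
                 nabla_tensor D (hor_field \<A> D X) (A_tensor \<A> D D') Y Z u = 0)))"
proof -
  interpret smooth_atlas \<A> by (rule smooth_manifold_imp_smooth_atlas[OF assms(1)])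
  have regular: "regular_pi_connection \<A> D" "regular_pi_connection \<A> D'"
    using assms(4,5) unfolding cartan_connection_def by (unfold_locales; blast)+
  interpret equal_horizontal_transport \<A> D D'
    by (rule equal_horizontal_transportI[OF regular assms(6)])
  interpret swap: equal_horizontal_transport \<A> D' D
    by unfold_locales (rule hor_field_eq[symmetric] conn_hor_eq[symmetric], assumption+)+
  have S: "S_tensor \<A> D X Y u = 0" "S_tensor \<A> D' X Y u = 0"
    if "X \<in> pi_fields \<A>" "Y \<in> pi_fields \<A>" "u \<in> slit_bundle \<A>" for X Y u
    using assms(4,5) that unfolding cartan_connection_def by blast+
  let ?flat = "\<lambda>D. \<forall>X\<in>pi_fields \<A>. \<forall>Y\<in>pi_fields \<A>. \<forall>Z\<in>pi_fields \<A>. \<forall>u\<in>slit_bundle \<A>. R_tensor \<A> D X Y Z u = 0"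
  have flat: "?flat D \<longleftrightarrow> ?flat D'"
  proof
    assume R: "?flat D"
    then show "?flat D'"
      using R_tensor_eq_of_flat[OF _ _ _ _ S(1)] eta_pi_field by metis
  next
    assume R: "?flat D'"
    then show "?flat D"
      using swap.R_tensor_eq_of_flat[OF _ _ _ _ S(2)] eta_pi_field by metis
  qed
  show ?thesis
    using assms(2-5) flat nabla_A_tensor unfolding locally_minkowskian_def by auto
qed

end
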